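(* On the space $C_{\{2\}}$ of nonempty compact graphs on $\mathcal C$ with continuous chromatic number two, both topological graph isomorphism $\cong_{\mathrm{top}}$ and mutual injective continuous graph homomorphism $\approx_c^i$ are complete analytic relations (as subsets of $C_{\{2\}}^2$). Both relations remain complete analytic on the larger space $C_{[2,3]}$ of nonempty compact graphs on $\mathcal C$ with continuous chromatic number two or three (as subsets of $C_{[2,3]}^2$).
   Context: $\mathcal C=\{0,1\}^{\mathbb N}$ is the Cantor set; $\mathrm K(\mathcal C^2)$ is the space of nonempty compact subsets of $\mathcal C^2$ with the Vietoris topology. A graph on a topological space $V$ is a symmetric irreflexive relation $E\subseteq V^2$. A continuous $k$-coloring is a continuous map $c:V\to\{0,\dots,k-1\}$ (discrete range) with $c(x)\ne c(y)$ whenever $(x,y)\in E$; the continuous chromatic number $\chi_c(V,E)$ is the least finite $k$ admitting a continuous $k$-coloring, and $\infty$ if there is none. Graphs on $\mathcal C$ are coded by their edge sets: $$C_{[2,3]}=\{E\in\mathrm K(\mathcal C^2): E \text{ symmetric},\ E\cap\{(x,x):x\in\mathcal C\}=\varnothing,\ 2\le\chi_c(\mathcal C,E)\le3\},$$ $C_{\{2\}}=\{E\in C_{[2,3]}:\chi_c(\mathcal C,E)=2\}$, with the subspace topologies (both are Polish). Write $(V,E)\preceq_c^i(V',E')$ if there is an injective continuous $f:V\to V'$ with $(x,y)\in E\Rightarrow(f(x),f(y))\in E'$; $(V,E)\approx_c^i(V',E')$ means that $\preceq_c^i$ holds in both directions. $(V,E)\cong_{\mathrm{top}}(V',E')$ means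 that there is a homeomorphism $f:V\to V'$ with $(f\times f)(E)=E'$. For $E,E'\subseteq\mathcal C^2$ these are relations between $(\mathcal C,E)$ and $(\mathcal C,E')$. A subset $A$ of a Polish space $X$ is analytic if it is a continuous image of a Polish space; an analytic set $A\subseteq X$ is complete analytic if for every analytic subset $B$ of a Polish space $Y$ there is a Borel map $g:Y\to X$ with $g^{-1}(A)=B$. *)

theory Defs
  imports "HOL-Analysis.Analysis"
begin

section \<open>Polish spaces, analytic sets, complete analytic sets\<close>

definition Polish_space :: "'a topology \<Rightarrow> bool" where
  "Polish_space X \<longleftrightarrow> completely_metrizable_space X \<and> separable_space X"

text \<open>
  HOL cannot quantify over types inside a definition, so the Polish spaces quantified over in the
  next two definitions are those whose points are sets of natural numbers, with an arbitrary
  topology on an arbitrary carrier.  Every Polish space is homeomorphic to one of these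
  (\<open>Polish_space_copy\<close>); the lemmas \<open>analytic_inI\<close> and \<open>complete_analytic_inD\<close> state that Polish
  spaces over any other type may be used instead.
\<close>

definition analytic_in :: "'a topology \<Rightarrow> 'a set \<Rightarrow> bool" where
  "analytic_in X A \<longleftrightarrow> Polish_space X \<and>
     (\<exists>(Z :: nat set topology) f. Polish_space Z \<and> continuous_map Z X f \<and> f ` topspace Z = A)"

definition borel_of :: "'a topology \<Rightarrow> 'a measure" where
  "borel_of X = sigma (topspace X) {U. openin X U}"

definition complete_analytic_in :: "'a topology \<Rightarrow> 'a set \<Rightarrow> bool" where
  "complete_analytic_in X A \<longleftrightarrow> analytic_in X A \<and>
     (\<forall>(Y :: nat set topology) B. Polish_space Y \<and> analytic_in Y B \<longrightarrow>
        (\<exists>g. g \<in> borel_of Y \<rightarrow>\<^sub>M borel_of X \<and> {y \<in> topspace Y. g y \<in> A} = B))"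

lemma separable_metrizable_inj:
  assumes "metrizable_space X" "separable_space X"
  shows "\<exists>h :: 'a \<Rightarrow> nat set. inj_on h (topspace (X :: 'a topology))"
proof -
  obtain M d where md: "Metric_space M d" and X: "X = Metric_space.mtopology M d"
    using assms(1) unfolding metrizable_space_def by blast
  interpret Metric_space M d by (rule md)
  have ts: "topspace X = M" by (simp add: X)
  obtain D where D: "countable D" "D \<subseteq> M" "mtopology closure_of D = M"
    using assms(2) unfolding separable_space_def ts unfolding X by blast
  define h :: "'a \<Rightarrow> nat set"
    where "h x = {to_nat (n, q :: rat) | n q. d x (from_nat_into D n) < of_rat q}" for x
  have "x = y" if x: "x \<in> M" and y: "y \<in> M" and eq: "h x = h y" for x y
  proof (rule ccontr)
    assume "x \<noteq> y"
    then have pos: "d x y / 2 > 0" using x y by simp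
    have "x \<in> mtopology closure_of D" using D x by simp
    then obtain e where e: "e \<in> D" "d x e < d x y / 2"
      using pos unfolding metric_closure_of mem_Collect_eq in_mball by blast
    obtain n where n: "from_nat_into D n = e"
      using from_nat_into_surj[OF D(1) e(1)] by blast
    obtain q where q: "d x e < of_rat q" "of_rat q < d x y / 2"
      using of_rat_dense[OF e(2)] by blast
    have "to_nat (n, q) \<in> h x" using q n by (auto simp: h_def)
    then have "to_nat (n, q) \<in> h y" using eq by simp
    then have "d y e < of_rat q" using n by (auto simp: h_def)
    moreover have "d x y \<le> d x e + d y e"
      using triangle[of x e y] commute[of e y] x y e D by auto
    ultimately show False using q by linarith
  qed
  then show ?thesis unfolding ts inj_on_def by blast
qed

lemma Polish_space_copy:
  assumes "Polish_space X"
  shows "\<exists>Z :: nat set topology. Polish_space Z \<and> X homeomorphic_space Z"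
proof -
  obtain h :: "'a \<Rightarrow> nat set" where h: "inj_on h (topspace X)"
    using separable_metrizable_inj assms completely_metrizable_imp_metrizable_space
    unfolding Polish_space_def by blast
  define i where "i = inv_into (topspace X) h"
  define Z where "Z = pullback_topology (h ` topspace X) i X"
  have ih: "i (h x) = x" if "x \<in> topspace X" for x using h that by (simp add: i_def)
  have Zt: "topspace Z = h ` topspace X"
    unfolding Z_def topspace_pullback_topology using ih by auto
  have "continuous_map Z X (id \<circ> i)"
    unfolding Z_def by (rule continuous_map_pullback) simp
  moreover have "continuous_map X X (i \<circ> h)"
    by (rule continuous_map_eq[OF continuous_map_id]) (simp add: ih)
  then have "continuous_map X Z h"
    unfolding Z_def by (rule continuous_map_pullback') auto
  ultimately have "homeomorphic_maps X Z h i"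
    unfolding homeomorphic_maps_def by (auto simp: ih Zt)
  then have hs: "X homeomorphic_space Z" unfolding homeomorphic_space_def by blast
  then have "Polish_space Z"
    using assms homeomorphic_completely_metrizable_space homeomorphic_separable_space
    unfolding Polish_space_def by blast
  with hs show ?thesis by blast
qed

lemma analytic_inI:
  fixes Z :: "'z topology"
  assumes "Polish_space X" "Polish_space Z" "continuous_map Z X f" "f ` topspace Z = A"
  shows "analytic_in X A"
proof -
  obtain Z' :: "nat set topology" where Z': "Polish_space Z'" "Z homeomorphic_space Z'"
    using Polish_space_copy[OF assms(2)] by blast
  then obtain u v where uv: "homeomorphic_maps Z' Z u v"
    unfolding homeomorphic_space_def using homeomorphic_maps_sym by blast
  then have "homeomorphic_map Z' Z u" by (simp add: homeomorphic_maps_map)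
  then have "u ` topspace Z' = topspace Z" by (rule homeomorphic_imp_surjective_map)
  then have surj: "(f \<circ> u) ` topspace Z' = A" using assms(4) by (simp flip: image_image)
  have "continuous_map Z' Z u" using uv by (simp add: homeomorphic_maps_def)
  then have "continuous_map Z' X (f \<circ> u)" using assms(3) by (rule continuous_map_compose)
  with surj show ?thesis
    unfolding analytic_in_def
    by (intro conjI assms(1) exI[of _ Z'] exI[of _ "f \<circ> u"] Z'(1))
qed

lemma borel_of_continuous:
  assumes "continuous_map X Y f"
  shows "f \<in> borel_of X \<rightarrow>\<^sub>M borel_of Y"
  unfolding borel_of_def
proof (rule measurable_sigma_sets[where A = "{U. openin Y U}" and \<Omega> = "topspace Y"])
  have sX: "{U. openin X U} \<subseteq> Pow (topspace X)" by (auto dest: openin_subset)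
  show "{U. openin Y U} \<subseteq> Pow (topspace Y)" by (auto dest: openin_subset)
  then show "sets (sigma (topspace Y) {U. openin Y U}) = sigma_sets (topspace Y) {U. openin Y U}"
    by (rule sets_measure_of)
  show "f \<in> space (sigma (topspace X) {U. openin X U}) \<rightarrow> topspace Y"
    using assms sX by (auto simp: continuous_map_def space_measure_of)
  fix U assume "U \<in> {U. openin Y U}"
  then have "openin X {x \<in> topspace X. f x \<in> U}"
    using assms unfolding continuous_map_def by blast
  moreover have "f -` U \<inter> space (sigma (topspace X) {U. openin X U})
      = {x \<in> topspace X. f x \<in> U}"
    using sX by (auto simp: space_measure_of)
  ultimately show "f -` U \<inter> space (sigma (topspace X) {U. openin X U})
      \<in> sets (sigma (topspace X) {U. openin X U})"
    using sX by (auto simp: sets_measure_of)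
qed

lemma complete_analytic_inD:
  fixes Y :: "'y topology"
  assumes A: "complete_analytic_in X A" and B: "analytic_in Y B"
  shows "\<exists>g. g \<in> borel_of Y \<rightarrow>\<^sub>M borel_of X \<and> {y \<in> topspace Y. g y \<in> A} = B"
proof -
  have "Polish_space Y" using B by (simp add: analytic_in_def)
  then obtain Y' :: "nat set topology" where Y': "Polish_space Y'" "Y homeomorphic_space Y'"
    using Polish_space_copy by blast
  then obtain u v where uv: "homeomorphic_maps Y Y' u v"
    unfolding homeomorphic_space_def by blast
  then have cu: "continuous_map Y Y' u" and vu: "\<And>y. y \<in> topspace Y \<Longrightarrow> v (u y) = y"
    unfolding homeomorphic_maps_def by simp_all
  obtain Z :: "nat set topology" and f
    where Z: "Polish_space Z" "continuous_map Z Y f" "f ` topspace Z = B"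
    using B unfolding analytic_in_def by blast
  have BY: "B \<subseteq> topspace Y" 
    using continuous_map_image_subset_topspace[OF Z(2)] Z(3) by simp
  have "continuous_map Z Y' (u \<circ> f)" using Z(2) cu by (rule continuous_map_compose)
  moreover have "(u \<circ> f) ` topspace Z = u ` B" using Z(3) by auto
  ultimately have "analytic_in Y' (u ` B)" by (rule analytic_inI[OF Y'(1) Z(1)])
  moreover have "Polish_space Y' \<and> analytic_in Y' C \<Longrightarrow>
      \<exists>g. g \<in> borel_of Y' \<rightarrow>\<^sub>M borel_of X \<and> {y \<in> topspace Y'. g y \<in> A} = C" for C
    using A unfolding complete_analytic_in_def by simp
  ultimately obtain g where g: "g \<in> borel_of Y' \<rightarrow>\<^sub>M borel_of X" "{y \<in> topspace Y'. g y \<in> A} = u ` B"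
    using Y'(1) by meson
  have "g \<circ> u \<in> borel_of Y \<rightarrow>\<^sub>M borel_of X"
    using borel_of_continuous[OF cu] g(1) by (rule measurable_comp)
  moreover have "{y \<in> topspace Y. (g \<circ> u) y \<in> A} = B"
  proof (intro equalityI subsetI)
    fix y assume y: "y \<in> {y \<in> topspace Y. (g \<circ> u) y \<in> A}"
    then have "u y \<in> topspace Y'"
      using continuous_map_image_subset_topspace[OF cu] by auto
    then have "u y \<in> u ` B" using y g(2) by auto
    then obtain b where "b \<in> B" "u y = u b" by blast
    then have "y = b" using vu[of y] vu[of b] y BY by auto
    then show "y \<in> B" using \<open>b \<in> B\<close> by simp
  next
    fix y assume "y \<in> B"
    then show "y \<in> {y \<in> topspace Y. (g \<circ> u) y \<in> A}" using g(2) BY by auto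
  qed
  ultimately show ?thesis by (intro exI[of _ "g \<circ> u"] conjI)
qed

section \<open>The Vietoris hyperspace\<close>

definition nonempty_compacts :: "'a::topological_space set set" where
  "nonempty_compacts = {K. compact K \<and> K \<noteq> {}}"

definition vietoris :: "'a::topological_space set topology" where
  "vietoris = topology_generated_by
     ({{K \<in> nonempty_compacts. K \<subseteq> U} | U. open U} \<union>
      {{K \<in> nonempty_compacts. K \<inter> U \<noteq> {}} | U. open U})"

lemma topspace_vietoris: "topspace vietoris = nonempty_compacts"
  unfolding vietoris_def topology_generated_by_topspace by blast

section \<open>Graphs on topological spaces\<close>

text \<open>The vertex set of every graph below is the whole ambient type, so a graph is its edge set.\<close>

definition continuous_coloring ::
    "('a::topological_space \<times> 'a) set \<Rightarrow> nat \<Rightarrow> ('a \<Rightarrow> nat) \<Rightarrow> bool" where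
  "continuous_coloring E k c \<longleftrightarrow>
     continuous_on UNIV c \<and> range c \<subseteq> {..<k} \<and> (\<forall>(x, y) \<in> E. c x \<noteq> c y)"

definition chi_c :: "('a::topological_space \<times> 'a) set \<Rightarrow> enat" where
  "chi_c E = (if \<exists>k c. continuous_coloring E k c
              then enat (LEAST k. \<exists>c. continuous_coloring E k c) else \<infinity>)"

definition inj_cont_hom_le ::
    "('a::topological_space \<times> 'a) set \<Rightarrow> ('b::topological_space \<times> 'b) set \<Rightarrow> bool"
    (infix \<open>\<preceq>\<^sub>c\<^sup>i\<close> 50) where
  "E \<preceq>\<^sub>c\<^sup>i E' \<longleftrightarrow>
     (\<exists>f. inj f \<and> continuous_on UNIV f \<and> (\<forall>(x, y) \<in> E. (f x, f y) \<in> E'))"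

definition inj_cont_hom_equiv ::
    "('a::topological_space \<times> 'a) set \<Rightarrow> ('b::topological_space \<times> 'b) set \<Rightarrow> bool"
    (infix \<open>\<approx>\<^sub>c\<^sup>i\<close> 50) where
  "E \<approx>\<^sub>c\<^sup>i E' \<longleftrightarrow> E \<preceq>\<^sub>c\<^sup>i E' \<and> E' \<preceq>\<^sub>c\<^sup>i E"

definition top_graph_iso ::
    "('a::topological_space \<times> 'a) set \<Rightarrow> ('b::topological_space \<times> 'b) set \<Rightarrow> bool"
    (infix \<open>\<cong>\<^sub>t\<^sub>o\<^sub>p\<close> 50) where
  "E \<cong>\<^sub>t\<^sub>o\<^sub>p E' \<longleftrightarrow> (\<exists>f g. homeomorphism UNIV UNIV f g \<and> map_prod f f ` E = E')"

section \<open>Compact graphs on the Cantor set\<close>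

text \<open>The library gives \<^typ>\<open>bool\<close> the discrete and \<^typ>\<open>nat \<Rightarrow> bool\<close> the product topology.\<close>

type_synonym cantor = "nat \<Rightarrow> bool"

definition C23 :: "(cantor \<times> cantor) set set" where
  "C23 = {E \<in> nonempty_compacts. sym E \<and> E \<inter> Id = {} \<and>
            2 \<le> chi_c E \<and> chi_c E \<le> 3}"

definition C2 :: "(cantor \<times> cantor) set set" where
  "C2 = {E \<in> C23. chi_c E = 2}"

definition C23_space :: "(cantor \<times> cantor) set topology" where
  "C23_space = subtopology vietoris C23"

definition C2_space :: "(cantor \<times> cantor) set topology" where
  "C2_space = subtopology vietoris C2"

end

theory Submission
  imports Defs
begin

text \<open>
  An analytic set \<open>B\<close> is \<open>{y. \<exists>\<alpha>. \<forall>j. y \<in> C (\<alpha> restricted to j)}\<close> for closed sets indexed by finite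
  sequences. To a set \<open>N\<close> of forbidden sequences we attach two compact bipartite graphs in the style of
  Cai, Furer and Immerman: each sequence contributes, for each \<open>k\<close>, a two-point fibre (a variable over
  the field with two elements), and gadgets force the set of swapped fibres of an isomorphism to
  satisfy \<open>x(s, k) = x(s, k + 1) + x(s^k, 0)\<close>. The two graphs differ only in which point of the root
  fibre is marked, so an isomorphism has to swap the root fibre, while the fibres of forbidden
  sequences must not be swapped. As \<open>k\<close> grows, the fibres \<open>(s, k)\<close> converge to a rigid fibre, so by
  continuity \<open>x(s, k)\<close> vanishes for large \<open>k\<close>; hence a swap at \<open>s\<close> propagates to some extension of
  \<open>s\<close> by one term, and ultimately along an infinite branch avoiding \<open>N\<close>. Conversely, an infinite
  branch gives a solution and thus a homeomorphism. A skeleton of vertices of infinite degree and a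
  ray hanging from it force even injective continuous homomorphisms to preserve all fibres.
\<close>

section \<open>Compact zero-dimensional spaces\<close>

text \<open>For K terms the equations at s telescope to x(s, 0) = x(s, K) plus the sum of x(s^k, 0)
  over k < K. So gadgets on three fibres express a sum over all one-term extensions of s. The
  obstacle is that x(s, k) = 1 for all k, with no extension swapped, solves the equations at s as
  well. It is excluded only by continuity at the limit fibre, and this is what turns a solution into
  an infinite branch. One reduction serves all four claims. Points of B yield a homeomorphism
  between the two graphs, and all other points exclude even a single injective continuous
  homomorphism from the first graph to the second. Hence B is reduced to every relation that lies
  between the isomorphism of graphs in \<open>C2\<close> and
  \<open>\<preceq>\<^sub>c\<^sup>i\<close>. The vertex set is the whole Cantor space, of which the
  combinatorial vertices fill a countable part. A homomorphism is analysed only on that part, while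
  a homeomorphism has to be supplied everywhere. For the upper bounds, continuous maps are coded by
  points of the Baire space, with injectivity expressed by a coded left inverse. The relations then
  become projections of closed sets.\<close>

instance bool :: second_countable_topology
proof
  have "open = (generate_topology UNIV :: bool set \<Rightarrow> bool)"
    by (auto intro!: ext generate_topology.Basis open_discrete)
  then show "\<exists>B :: bool set set. countable B \<and> open = generate_topology B"
    by (meson countable_finite finite)
qed

text \<open>The library obtains the Hausdorff property of function types only from \<^class>\<open>metric_space\<close>.\<close>

instantiation bool :: metric_space
begin

definition dist_bool :: "bool \<Rightarrow> bool \<Rightarrow> real" where
  "dist_bool x y = of_bool (x \<noteq> y)"

definition uniformity_bool :: "(bool \<times> bool) filter" where
  "uniformity_bool = (INF e\<in>{0<..}. principal {(x, y). dist x y < e})"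

instance
proof
  fix U :: "bool set"
  have "eventually (\<lambda>(x', y). x' = x \<longrightarrow> y \<in> U) uniformity" if "x \<in> U" for x
    unfolding uniformity_bool_def
    by (rule eventually_INF1[of 1]) (use that in \<open>auto simp: eventually_principal dist_bool_def\<close>)
  then show "open U \<longleftrightarrow> (\<forall>x\<in>U. \<forall>\<^sub>F (x', y) in uniformity. x' = x \<longrightarrow> y \<in> U)"
    by (simp add: open_discrete)
qed (auto simp: uniformity_bool_def dist_bool_def)

end

text \<open>Covers the Cantor space of vertices and its square, in which the edge sets live.\<close>

class compact_zero_dim = t2_space + second_countable_topology +
  assumes compact_UNIV: "compact UNIV"
    and clopen_nbhd: "open U \<Longrightarrow> x \<in> U \<Longrightarrow> \<exists>V. open V \<and> closed V \<and> x \<in> V \<and> V \<subseteq> U"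

lemma open_eval: "open {f :: 'a \<Rightarrow> 'b :: topological_space. f i \<in> U}" if "open U"
  using open_vimage[OF that continuous_on_product_coordinates[of i]] by (simp add: vimage_def)

lemma closed_eval: "closed {f :: 'a \<Rightarrow> 'b :: topological_space. f i \<in> U}" if "closed U"
  using closed_vimage[OF that continuous_on_product_coordinates[of i]] by (simp add: vimage_def)

instance "fun" :: (countable, "{finite, discrete_topology, metric_space, second_countable_topology}") compact_zero_dim
proof
  have "compact_space (euclidean :: 'b topology)"
    by (simp add: compact_space_def compactin_euclidean_iff finite_imp_compact)
  then have "compact_space (euclidean :: ('a \<Rightarrow> 'b) topology)"
    unfolding euclidean_product_topology[symmetric] by (simp add: compact_space_product_topology)
  then show "compact (UNIV :: ('a \<Rightarrow> 'b) set)"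
    by (simp add: compact_space_def compactin_euclidean_iff)
next
  fix U :: "('a \<Rightarrow> 'b) set" and x
  assume U: "open U" "x \<in> U"
  then have "openin (product_topology (\<lambda>_. euclidean) UNIV) U"
    by (simp add: euclidean_product_topology)
  from product_topology_open_contains_basis[OF this U(2)]
  obtain X where X: "x \<in> Pi\<^sub>E UNIV X" "finite {i. X i \<noteq> UNIV}" "Pi\<^sub>E UNIV X \<subseteq> U"
    by auto
  define I where "I = {i. X i \<noteq> UNIV}"
  define V where "V = (\<Inter>i\<in>I. {f. f i \<in> X i})"
  have V: "V = Pi\<^sub>E UNIV X" unfolding V_def I_def PiE_def by fastforce
  have "open V" unfolding V_def
    using X(2) by (intro open_INT) (auto simp: I_def intro!: open_eval open_discrete)
  moreover have "closed V" unfolding V_def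
    by (intro closed_INT ballI closed_eval) (simp add: closed_def open_discrete)
  ultimately show "\<exists>V. open V \<and> closed V \<and> x \<in> V \<and> V \<subseteq> U"
    using X V by blast
qed

instance prod :: (compact_zero_dim, compact_zero_dim) compact_zero_dim
proof
  show "compact (UNIV :: ('a \<times> 'b) set)"
    using compact_Times[OF compact_UNIV compact_UNIV] by simp
next
  fix U :: "('a \<times> 'b) set" and x
  assume "open U" "x \<in> U"
  then obtain A B where AB: "open A" "open B" "x \<in> A \<times> B" "A \<times> B \<subseteq> U"
    by (rule open_prod_elim)
  obtain A' where A': "open A'" "closed A'" "fst x \<in> A'" "A' \<subseteq> A"
    using clopen_nbhd[OF AB(1), of "fst x"] AB(3) by auto
  obtain B' where B': "open B'" "closed B'" "snd x \<in> B'" "B' \<subseteq> B"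
    using clopen_nbhd[OF AB(2), of "snd x"] AB(3) by auto
  show "\<exists>V. open V \<and> closed V \<and> x \<in> V \<and> V \<subseteq> U"
    using A' B' AB(4) by (intro exI[of _ "A' \<times> B'"]) (auto intro: open_Times closed_Times simp: mem_Times_iff)
qed

lemma compact_iff_closed: "compact (K :: 'a :: compact_zero_dim set) \<longleftrightarrow> closed K"
  using compact_imp_closed compact_Int_closed[OF compact_UNIV, of K] by auto

lemma clopen_between:
  fixes K :: "'a :: compact_zero_dim set"
  assumes "closed K" "open U" "K \<subseteq> U"
  obtains V where "open V" "closed V" "K \<subseteq> V" "V \<subseteq> U"
proof -
  have "\<forall>x\<in>K. \<exists>V. open V \<and> closed V \<and> x \<in> V \<and> V \<subseteq> U"
    using assms clopen_nbhd by blast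
  then obtain W where W: "\<And>x. x \<in> K \<Longrightarrow> open (W x) \<and> closed (W x) \<and> x \<in> W x \<and> W x \<subseteq> U"
    by metis
  have "compact K" using assms compact_iff_closed by blast
  then obtain F where F: "F \<subseteq> K" "finite F" "K \<subseteq> (\<Union>x\<in>F. W x)"
    by (rule compactE_image[of K K W]) (use W in auto)
  show thesis
    using F W by (intro that[of "\<Union>x\<in>F. W x"]) (auto intro!: open_UN closed_UN)
qed

text \<open>A clopen set is compact, hence a finite union of members of a countable basis.\<close>

lemma countable_clopens: "countable {U :: 'a :: compact_zero_dim set. open U \<and> closed U}"
proof -
  obtain \<B> :: "'a set set" where \<B>: "countable \<B>" "topological_basis \<B>"
    using ex_countable_basis by blast
  have "{U :: 'a set. open U \<and> closed U} \<subseteq> Union ` {F. finite F \<and> F \<subseteq> \<B>}"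
  proof
    fix U :: "'a set"
    assume "U \<in> {U. open U \<and> closed U}"
    then have U: "open U" "compact U" by (auto simp: compact_iff_closed)
    obtain \<A> where \<A>: "\<A> \<subseteq> \<B>" "U = \<Union>\<A>"
      using \<B>(2) U(1) unfolding topological_basis_def by metis
    have "\<forall>B\<in>\<A>. open B"
      using \<A>(1) \<B>(2) topological_basis_open by blast
    then obtain F where "F \<subseteq> \<A>" "finite F" "U \<subseteq> \<Union>F"
      using compactE[OF U(2), of \<A>] \<A>(2) by blast
    then show "U \<in> Union ` {F. finite F \<and> F \<subseteq> \<B>}"
      using \<A> by (intro image_eqI[of _ _ F]) auto
  qed
  moreover have "countable {F. finite F \<and> F \<subseteq> \<B>}"
    using countable_Collect_finite_subset[OF \<B>(1)] by simp
  ultimately show ?thesis by (meson countable_image countable_subset)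
qed

text \<open>Clopen sets are referred to by index, so that compact sets and continuous maps can be
  coded by sequences of bits or numbers.\<close>

definition clop :: "nat \<Rightarrow> 'a :: compact_zero_dim set" where
  "clop = from_nat_into {U. open U \<and> closed U}"

lemma clop_clopen [simp]:
  "open (clop n :: 'a :: compact_zero_dim set)" "closed (clop n :: 'a set)"
proof -
  have "{U :: 'a set. open U \<and> closed U} \<noteq> {}" by (auto intro: exI[of _ "{}"])
  then have "clop n \<in> {U :: 'a set. open U \<and> closed U}"
    unfolding clop_def by (rule from_nat_into)
  then show "open (clop n :: 'a set)" "closed (clop n :: 'a set)" by auto
qed

lemma clop_surj:
  assumes "open U" "closed U"
  obtains n where "clop n = U"
  using from_nat_into_surj[OF countable_clopens, of U] assms unfolding clop_def by blast

section \<open>Polishness of the hyperspace and of the graph spaces\<close>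

lemma second_countable_euclidean:
  "second_countable (euclidean :: 'a :: second_countable_topology topology)"
proof -
  obtain \<B> :: "'a set set" where \<B>: "countable \<B>" "topological_basis \<B>"
    using ex_countable_basis by blast
  show ?thesis unfolding second_countable_def
  proof (intro exI[of _ \<B>] conjI allI impI ballI)
    show "openin euclidean V" if "V \<in> \<B>" for V
      using topological_basis_open[OF \<B>(2) that] by simp
    show "\<exists>V\<in>\<B>. x \<in> V \<and> V \<subseteq> U" if "openin euclidean U \<and> x \<in> U" for U x
      using topological_basisE[OF \<B>(2)] that by (metis open_openin)
  qed (rule \<B>(1))
qed

lemma second_countable_prod_topology:
  assumes "second_countable X" "second_countable Y"
  shows "second_countable (prod_topology X Y)"
proof -
  obtain \<A> where A: "countable \<A>" "\<And>V. V \<in> \<A> \<Longrightarrow> openin X V"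
      "\<And>U x. openin X U \<Longrightarrow> x \<in> U \<Longrightarrow> \<exists>V\<in>\<A>. x \<in> V \<and> V \<subseteq> U"
    using assms(1) unfolding second_countable_def by metis
  obtain \<B> where B: "countable \<B>" "\<And>V. V \<in> \<B> \<Longrightarrow> openin Y V"
      "\<And>U x. openin Y U \<Longrightarrow> x \<in> U \<Longrightarrow> \<exists>V\<in>\<B>. x \<in> V \<and> V \<subseteq> U"
    using assms(2) unfolding second_countable_def by metis
  show ?thesis unfolding second_countable_def
  proof (intro exI[of _ "(\<lambda>(a, b). a \<times> b) ` (\<A> \<times> \<B>)"] conjI allI impI ballI)
    show "countable ((\<lambda>(a, b). a \<times> b) ` (\<A> \<times> \<B>))" using A(1) B(1) by simp
    show "openin (prod_topology X Y) V" if "V \<in> (\<lambda>(a, b). a \<times> b) ` (\<A> \<times> \<B>)" for V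
      using that A(2) B(2) by (auto simp: openin_prod_Times_iff)
    fix U x
    assume "openin (prod_topology X Y) U \<and> x \<in> U"
    then obtain S T where ST: "openin X S" "openin Y T" "fst x \<in> S" "snd x \<in> T" "S \<times> T \<subseteq> U"
      unfolding openin_prod_topology_alt by (metis prod.collapse)
    obtain S' where "S' \<in> \<A>" "fst x \<in> S'" "S' \<subseteq> S" using A(3)[OF ST(1,3)] by blast
    moreover obtain T' where "T' \<in> \<B>" "snd x \<in> T'" "T' \<subseteq> T" using B(3)[OF ST(2,4)] by blast
    ultimately show "\<exists>V\<in>(\<lambda>(a, b). a \<times> b) ` (\<A> \<times> \<B>). x \<in> V \<and> V \<subseteq> U"
      using ST(5) by (intro bexI[of _ "S' \<times> T'"]) (auto simp: mem_Times_iff)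
  qed
qed

text \<open>Second countability replaces separability because it passes to all subspaces.\<close>

definition Polish :: "'a topology \<Rightarrow> bool" where
  "Polish X \<longleftrightarrow> completely_metrizable_space X \<and> second_countable X"

lemma Polish_imp_Polish_space: "Polish X \<Longrightarrow> Polish_space X"
  by (simp add: Polish_def Polish_space_def second_countable_imp_separable_space)

lemma Polish_prod_topology:
  "Polish X \<Longrightarrow> Polish Y \<Longrightarrow> Polish (prod_topology X Y)"
  by (simp add: Polish_def second_countable_prod_topology completely_metrizable_space_prod_topology)

lemma Polish_closedin: "Polish X \<Longrightarrow> closedin X S \<Longrightarrow> Polish (subtopology X S)"
  by (simp add: Polish_def second_countable_subtopology completely_metrizable_space_closedin)

lemma Polish_openin: "Polish X \<Longrightarrow> openin X S \<Longrightarrow> Polish (subtopology X S)"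
  by (simp add: Polish_def second_countable_subtopology completely_metrizable_space_openin)

lemma Polish_homeomorphic:
  assumes "Polish X" "X homeomorphic_space Y"
  shows "Polish Y"
proof -
  obtain f where f: "homeomorphic_map X Y f"
    using assms(2) homeomorphic_space by blast
  then have "second_countable Y"
    using second_countable_open_map_image[of X Y f] assms(1)
    unfolding Polish_def homeomorphic_map_def
    by (simp add: homeomorphic_eq_everything_map[of X Y f, THEN iffD1] f)
  then show ?thesis
    using assms homeomorphic_completely_metrizable_space unfolding Polish_def by blast
qed

lemma Polish_sequences:
  "Polish (euclidean :: (nat \<Rightarrow> 'a :: {discrete_topology, second_countable_topology}) topology)"
proof -
  have "(euclidean :: 'a topology) = discrete_topology UNIV"
    by (rule topology_eq[THEN iffD2]) (simp add: open_discrete)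
  then have "completely_metrizable_space (product_topology (\<lambda>_ :: nat. euclidean :: 'a topology) UNIV)"
    by (simp add: completely_metrizable_space_product_topology completely_metrizable_space_discrete_topology)
  then show ?thesis
    by (simp add: Polish_def euclidean_product_topology second_countable_euclidean)
qed

section \<open>The Vietoris topology and its coding\<close>

lemma openin_vietoris_subset: "open U \<Longrightarrow> openin vietoris {K \<in> nonempty_compacts. K \<subseteq> U}"
  unfolding vietoris_def by (rule topology_generated_by_Basis) blast

lemma openin_vietoris_meets: "open U \<Longrightarrow> openin vietoris {K \<in> nonempty_compacts. K \<inter> U \<noteq> {}}"
  unfolding vietoris_def by (rule topology_generated_by_Basis) blast

lemma continuous_map_vietorisI:
  assumes "\<And>x. x \<in> topspace X \<Longrightarrow> f x \<in> nonempty_compacts"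
    and "\<And>U. open U \<Longrightarrow> openin X {x \<in> topspace X. f x \<subseteq> U}"
    and "\<And>U. open U \<Longrightarrow> openin X {x \<in> topspace X. f x \<inter> U \<noteq> {}}"
  shows "continuous_map X vietoris f"
  unfolding vietoris_def
proof (rule continuous_on_generated_topo)
  show "f ` topspace X \<subseteq> \<Union> ({{K \<in> nonempty_compacts. K \<subseteq> U} | U. open U} \<union>
      {{K \<in> nonempty_compacts. K \<inter> U \<noteq> {}} | U. open U})"
    using assms(1) by blast
  fix \<U> :: "'b set set"
  assume "\<U> \<in> {{K \<in> nonempty_compacts. K \<subseteq> U} | U. open U} \<union>
      {{K \<in> nonempty_compacts. K \<inter> U \<noteq> {}} | U. open U}"
  then consider U where "open U" "\<U> = {K \<in> nonempty_compacts. K \<subseteq> U}"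
    | U where "open U" "\<U> = {K \<in> nonempty_compacts. K \<inter> U \<noteq> {}}" by blast
  then show "openin X (f -` \<U> \<inter> topspace X)"
  proof cases
    case 1
    then have "f -` \<U> \<inter> topspace X = {x \<in> topspace X. f x \<subseteq> U}" using assms(1) by blast
    with assms(2)[OF 1(1)] show ?thesis by simp
  next
    case 2
    then have "f -` \<U> \<inter> topspace X = {x \<in> topspace X. f x \<inter> U \<noteq> {}}" using assms(1) by blast
    with assms(3)[OF 2(1)] show ?thesis by simp
  qed
qed

lemma continuous_map_boolI:
  fixes P :: "'a \<Rightarrow> bool"
  assumes "openin X {x \<in> topspace X. P x}" "openin X {x \<in> topspace X. \<not> P x}"
  shows "continuous_map X euclidean P"
proof (rule continuous_map_openin_preimage_eq[THEN iffD2], intro conjI allI impI)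
  fix U :: "bool set"
  have "topspace X \<inter> P -` U =
      (if True \<in> U then {x \<in> topspace X. P x} else {}) \<union>
      (if False \<in> U then {x \<in> topspace X. \<not> P x} else {})"
    by (rule set_eqI) (case_tac "P x", simp_all)
  also have "openin X \<dots>" using assms by (intro openin_Un) auto
  finally show "openin X (topspace X \<inter> P -` U)" .
qed auto

lemma continuous_map_into_fun:
  "continuous_map X (euclidean :: ('a \<Rightarrow> 'b :: topological_space) topology) f \<longleftrightarrow>
    (\<forall>i. continuous_map X euclidean (\<lambda>x. f x i))"
  by (simp add: euclidean_product_topology[symmetric] continuous_map_componentwise_UNIV)

text \<open>A compact set is coded by the clopen sets that it meets; by compactness the codes are described
  by the finitary conditions in \<open>hit_codes\<close>, hence form a closed set.\<close>

definition hits :: "'a :: compact_zero_dim set \<Rightarrow> nat \<Rightarrow> bool" where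
  "hits K n \<longleftrightarrow> K \<inter> clop n \<noteq> {}"

definition unhits :: "(nat \<Rightarrow> bool) \<Rightarrow> 'a :: compact_zero_dim set" where
  "unhits c = (\<Inter>n\<in>{n. \<not> c n}. - clop n)"

definition hit_codes :: "'a :: compact_zero_dim itself \<Rightarrow> (nat \<Rightarrow> bool) set" where
  "hit_codes _ = {c. (\<forall>n. clop n = ({} :: 'a set) \<longrightarrow> \<not> c n) \<and> (\<forall>n. clop n = (UNIV :: 'a set) \<longrightarrow> c n) \<and>
     (\<forall>i j k. clop k = (clop i \<union> clop j :: 'a set) \<longrightarrow> (c k \<longleftrightarrow> c i \<or> c j))}"

lemma closed_coordinate: "closed {c :: nat \<Rightarrow> bool. c i}" "closed {c :: nat \<Rightarrow> bool. \<not> c i}"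
  using closed_eval[of "{True}" i] closed_eval[of "{False}" i] by simp_all

lemma open_coordinate: "open {c :: nat \<Rightarrow> bool. c i}" "open {c :: nat \<Rightarrow> bool. \<not> c i}"
  using open_eval[of "{True}" i] open_eval[of "{False}" i] by (simp_all add: open_discrete)

lemma closed_hit_codes: "closed (hit_codes TYPE('a :: compact_zero_dim))"
proof -
  have un: "closed {c :: nat \<Rightarrow> bool. c k \<longleftrightarrow> c i \<or> c j}" for i j k
  proof -
    have "{c :: nat \<Rightarrow> bool. c k \<longleftrightarrow> c i \<or> c j} =
        ({c. c k} \<inter> ({c. c i} \<union> {c. c j})) \<union> ({c. \<not> c k} \<inter> {c. \<not> c i} \<inter> {c. \<not> c j})" by auto
    then show ?thesis by (simp add: closed_Un closed_Int closed_coordinate)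
  qed
  have "hit_codes TYPE('a) = (\<Inter>n\<in>{n. clop n = ({} :: 'a set)}. {c. \<not> c n}) \<inter>
      (\<Inter>n\<in>{n. clop n = (UNIV :: 'a set)}. {c. c n}) \<inter>
      (\<Inter>(i, j, k)\<in>{(i, j, k). clop k = (clop i \<union> clop j :: 'a set)}. {c. c k \<longleftrightarrow> c i \<or> c j})"
    unfolding hit_codes_def by blast
  then show ?thesis
    by (auto intro!: closed_Int closed_INT closed_coordinate un)
qed

lemma unhits_hits:
  assumes "K \<in> nonempty_compacts"
  shows "unhits (hits K) = (K :: 'a :: compact_zero_dim set)"
proof
  show "K \<subseteq> unhits (hits K)" by (auto simp: unhits_def hits_def)
  show "unhits (hits K) \<subseteq> K"
  proof (rule subsetI, rule ccontr)
    fix x assume x: "x \<in> unhits (hits K)" "x \<notin> K"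
    have "open (- K)" using assms by (simp add: nonempty_compacts_def compact_imp_closed open_Compl)
    then obtain V where V: "open V" "closed V" "x \<in> V" "V \<subseteq> - K" using clopen_nbhd x(2) by blast
    obtain n where "clop n = V" using clop_surj[OF V(1,2)] .
    then show False using V x(1) by (auto simp: unhits_def hits_def)
  qed
qed

lemma hits_in_codes:
  assumes "K \<in> nonempty_compacts"
  shows "hits (K :: 'a :: compact_zero_dim set) \<in> hit_codes TYPE('a)"
  using assms by (auto simp: hit_codes_def hits_def nonempty_compacts_def)

text \<open>If \<open>unhits c\<close> misses \<open>clop n\<close>, the clopen sets rejected by c
  cover \<open>clop n\<close>, and by compactness finitely many do. Additivity of c rejects their
  union \<open>clop k\<close>. Since \<open>clop k = clop n \<union> clop k\<close>, it then rejects
  \<open>clop n\<close> too.\<close>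

lemma hits_unhits:
  assumes c: "c \<in> hit_codes TYPE('a :: compact_zero_dim)"
  shows "hits (unhits c :: 'a set) = c"
proof
  fix n
  have un: "c k \<longleftrightarrow> c i \<or> c j" if "clop k = (clop i \<union> clop j :: 'a set)" for i j k
    using c that by (simp add: hit_codes_def)
  show "hits (unhits c :: 'a set) n = c n"
  proof (rule iffI)
    show "hits (unhits c :: 'a set) n \<Longrightarrow> c n" by (auto simp: hits_def unhits_def)
    assume cn: "c n"
    show "hits (unhits c :: 'a set) n"
    proof (rule ccontr)
      assume "\<not> hits (unhits c :: 'a set) n"
      then have cover: "(clop n :: 'a set) \<subseteq> (\<Union>i\<in>{i. \<not> c i}. clop i)"
        by (auto simp: hits_def unhits_def)
      have "compact (clop n :: 'a set)" by (simp add: compact_iff_closed)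
      then obtain F where F: "F \<subseteq> {i. \<not> c i}" "finite F" "(clop n :: 'a set) \<subseteq> (\<Union>i\<in>F. clop i)"
        by (rule compactE_image[OF _ _ cover]) auto
      have "\<exists>k. (clop k :: 'a set) = (\<Union>i\<in>F. clop i) \<and> \<not> c k" using F(2,1)
      proof (induction F)
        case empty
        obtain k where "clop k = ({} :: 'a set)" using clop_surj[of "{} :: 'a set"] by auto
        then show ?case using c by (auto simp: hit_codes_def)
      next
        case (insert i F)
        then obtain k where k: "(clop k :: 'a set) = (\<Union>i\<in>F. clop i)" "\<not> c k" by blast
        have "open (clop i \<union> clop k :: 'a set)" "closed (clop i \<union> clop k :: 'a set)"
          by (simp_all add: open_Un closed_Un)
        then obtain l where l: "clop l = (clop i \<union> clop k :: 'a set)" by (rule clop_surj)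
        then have "\<not> c l" using un[OF l] insert.prems k by auto
        then show ?case using l k by auto
      qed
      then obtain k where k: "(clop k :: 'a set) = (\<Union>i\<in>F. clop i)" "\<not> c k" by blast
      then have "clop k = (clop n \<union> clop k :: 'a set)" using F(3) by auto
      then show False using un[of k n k] cn k(2) by blast
    qed
  qed
qed

lemma unhits_nonempty_compact:
  assumes "c \<in> hit_codes TYPE('a :: compact_zero_dim)"
  shows "unhits c \<in> (nonempty_compacts :: 'a set set)"
proof -
  have "closed (unhits c :: 'a set)" unfolding unhits_def
    by (intro closed_INT ballI) (simp add: closed_Compl)
  moreover obtain n where n: "clop n = (UNIV :: 'a set)" using clop_surj[of "UNIV :: 'a set"] by auto
  then have "hits (unhits c :: 'a set) n"
    using assms by (simp add: hits_unhits) (simp add: hit_codes_def)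
  ultimately show ?thesis by (auto simp: nonempty_compacts_def compact_iff_closed hits_def)
qed

lemma vietoris_homeomorphic_codes:
  "homeomorphic_maps vietoris (top_of_set (hit_codes TYPE('a))) hits
     (unhits :: _ \<Rightarrow> 'a :: compact_zero_dim set)"
  unfolding homeomorphic_maps_def topspace_vietoris
proof (intro conjI ballI)
  have "continuous_map vietoris euclidean (\<lambda>K :: 'a set. hits K n)" for n
  proof (rule continuous_map_boolI)
    show "openin vietoris {K \<in> topspace vietoris. hits (K :: 'a set) n}"
      using openin_vietoris_meets[of "clop n :: 'a set"] by (simp add: topspace_vietoris hits_def)
    have "{K \<in> topspace vietoris. \<not> hits (K :: 'a set) n} = {K \<in> nonempty_compacts. K \<subseteq> - clop n}"
      by (auto simp: topspace_vietoris hits_def)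
    then show "openin vietoris {K \<in> topspace vietoris. \<not> hits (K :: 'a set) n}"
      using openin_vietoris_subset[of "- clop n :: 'a set"] by (simp add: open_Compl)
  qed
  then have "continuous_map vietoris euclidean (hits :: 'a set \<Rightarrow> _)"
    by (simp add: continuous_map_into_fun)
  then show "continuous_map vietoris (top_of_set (hit_codes TYPE('a))) (hits :: 'a set \<Rightarrow> _)"
    by (auto simp: continuous_map_in_subtopology topspace_vietoris hits_in_codes)
  let ?S = "hit_codes TYPE('a)"
  show "continuous_map (top_of_set ?S) vietoris (unhits :: _ \<Rightarrow> 'a set)"
  proof (rule continuous_map_vietorisI)
    fix U :: "'a set"
    assume U: "open U"
    \<comment> \<open>A clopen set between the complement of U and the complement of
      \<open>unhits c\<close> turns the inclusion into one negative bit of the code.\<close>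
    have "unhits c \<subseteq> U \<longleftrightarrow> (\<exists>n. - U \<subseteq> clop n \<and> \<not> c n)" if c: "c \<in> ?S" for c
    proof
      assume sub: "unhits c \<subseteq> U"
      have "closed (unhits c :: 'a set)"
        using unhits_nonempty_compact[OF c] by (simp add: nonempty_compacts_def compact_iff_closed)
      then obtain V where V: "open V" "closed V" "- U \<subseteq> V" "V \<subseteq> - unhits c"
        using clopen_between[of "- U" "- unhits c"] U sub by (metis Compl_subset_Compl_iff closed_Compl open_Compl)
      obtain n where n: "clop n = V" using clop_surj[OF V(1,2)] .
      then have "\<not> hits (unhits c :: 'a set) n" using V(4) by (auto simp: hits_def)
      then show "\<exists>n. - U \<subseteq> clop n \<and> \<not> c n" using n V(3) hits_unhits[OF c] by auto
    next
      assume "\<exists>n. - U \<subseteq> clop n \<and> \<not> c n"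
      then show "unhits c \<subseteq> U" by (auto simp: unhits_def)
    qed
    then have "{c \<in> topspace (top_of_set ?S). unhits c \<subseteq> U} = ?S \<inter> (\<Union>n\<in>{n. - U \<subseteq> clop n}. {c. \<not> c n})"
      by auto
    then show "openin (top_of_set ?S) {c \<in> topspace (top_of_set ?S). unhits c \<subseteq> U}"
      by (simp add: openin_open_Int open_UN open_coordinate)
    have "unhits c \<inter> U \<noteq> {} \<longleftrightarrow> (\<exists>n. clop n \<subseteq> U \<and> c n)" if c: "c \<in> ?S" for c
    proof
      assume "unhits c \<inter> U \<noteq> {}"
      then obtain x where x: "x \<in> unhits c" "x \<in> U" by blast
      obtain V where V: "open V" "closed V" "x \<in> V" "V \<subseteq> U" using clopen_nbhd[OF U x(2)] by blast
      obtain n where n: "clop n = V" using clop_surj[OF V(1,2)] .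
      then have "hits (unhits c :: 'a set) n" using V x by (auto simp: hits_def)
      then show "\<exists>n. clop n \<subseteq> U \<and> c n" using n V(4) hits_unhits[OF c] by auto
    next
      assume "\<exists>n. clop n \<subseteq> U \<and> c n"
      then obtain n where "clop n \<subseteq> U" "hits (unhits c :: 'a set) n" using hits_unhits[OF c] by auto
      then show "unhits c \<inter> U \<noteq> {}" by (auto simp: hits_def)
    qed
    then have "{c \<in> topspace (top_of_set ?S). unhits c \<inter> U \<noteq> {}} = ?S \<inter> (\<Union>n\<in>{n. clop n \<subseteq> U}. {c. c n})"
      by auto
    then show "openin (top_of_set ?S) {c \<in> topspace (top_of_set ?S). unhits c \<inter> U \<noteq> {}}"
      by (simp add: openin_open_Int open_UN open_coordinate)
  qed (simp add: unhits_nonempty_compact)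
qed (auto simp: unhits_hits hits_unhits)

lemma Polish_vietoris: "Polish (vietoris :: 'a :: compact_zero_dim set topology)"
proof -
  have "Polish (top_of_set (hit_codes TYPE('a)))"
    by (rule Polish_closedin[OF Polish_sequences]) (simp add: closed_hit_codes)
  then show ?thesis
    using Polish_homeomorphic vietoris_homeomorphic_codes homeomorphic_space_def homeomorphic_space_sym
    by blast
qed

section \<open>Spaces of graphs with a bounded continuous chromatic number\<close>

definition colorable_graphs :: "nat \<Rightarrow> ('a :: topological_space \<times> 'a) set set" where
  "colorable_graphs k = {E \<in> nonempty_compacts. sym E \<and> (\<exists>c. continuous_coloring E k c)}"

text \<open>If (x, y) is an edge and (y, x) is not, take a clopen V around (y, x) that misses E.
  Every graph that misses V and meets the mirror image of V fails to be symmetric.\<close>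

lemma closedin_vietoris_sym:
  "closedin vietoris {E \<in> nonempty_compacts. sym (E :: ('a :: compact_zero_dim \<times> 'a) set)}"
  unfolding closedin_def topspace_vietoris
proof (intro conjI)
  show "openin vietoris (nonempty_compacts - {E \<in> nonempty_compacts. sym (E :: ('a \<times> 'a) set)})"
  proof (subst openin_subopen, intro ballI)
    fix E :: "('a \<times> 'a) set"
    assume E: "E \<in> nonempty_compacts - {E \<in> nonempty_compacts. sym E}"
    then obtain x y where xy: "(x, y) \<in> E" "(y, x) \<notin> E" by (auto simp: sym_def)
    have "open (- E)" using E by (auto simp: nonempty_compacts_def compact_iff_closed)
    then obtain V where V: "open V" "closed V" "(y, x) \<in> V" "V \<subseteq> - E"
      using clopen_nbhd xy(2) by blast
    have swap: "open (prod.swap -` V)"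
      using V(1) by (rule open_vimage) (intro continuous_on_swap)
    let ?T = "{K \<in> nonempty_compacts. K \<subseteq> - V} \<inter> {K \<in> nonempty_compacts. K \<inter> (prod.swap -` V) \<noteq> {}}"
    have "openin vietoris ?T"
      by (intro openin_Int openin_vietoris_subset openin_vietoris_meets swap) (use V in auto)
    moreover have "E \<in> ?T" using E V xy by auto
    moreover have "\<not> sym K" if "K \<subseteq> - V" "z \<in> K" "prod.swap z \<in> V" for K z
      using that by (cases z) (auto simp: sym_def)
    then have "?T \<subseteq> nonempty_compacts - {E \<in> nonempty_compacts. sym E}" by blast
    ultimately show "\<exists>T. openin vietoris T \<and> E \<in> T \<and>
        T \<subseteq> nonempty_compacts - {E \<in> nonempty_compacts. sym E}" by blast
  qed
qed auto

text \<open>For a fixed continuous c the set of properly coloured pairs is open, so containment in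
  it is a basic Vietoris condition. The union over all c stays open.\<close>

lemma openin_vietoris_colorable:
  "openin vietoris {E :: ('a :: topological_space \<times> 'a) set. E \<in> nonempty_compacts \<and> (\<exists>c. continuous_coloring E k c)}"
proof -
  have eq: "{E :: ('a \<times> 'a) set. E \<in> nonempty_compacts \<and> (\<exists>c. continuous_coloring E k c)} =
      (\<Union>c\<in>{c. continuous_on UNIV c \<and> range c \<subseteq> {..<k}}. {E \<in> nonempty_compacts. E \<subseteq> {(x, y). c x \<noteq> c y}})"
    by (auto simp: continuous_coloring_def)
  have op: "open {(x, y). c x \<noteq> c y}" if "continuous_on UNIV c" for c :: "'a \<Rightarrow> nat"
  proof -
    have "{(x, y). c x \<noteq> c y} = (\<Union>n. (c -` {n}) \<times> (c -` (- {n})))" by auto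
    moreover have "open (c -` A)" for A
      by (rule open_vimage[OF open_discrete that])
    ultimately show ?thesis by (auto intro!: open_UN open_Times)
  qed
  show ?thesis
    unfolding eq by (rule openin_Union) (use op openin_vietoris_subset in blast)
qed

lemma Polish_colorable_graphs:
  "Polish (subtopology vietoris (colorable_graphs k :: ('a :: compact_zero_dim \<times> 'a) set set))"
proof -
  let ?S = "{E \<in> nonempty_compacts. sym (E :: ('a \<times> 'a) set)}"
  let ?C = "{E \<in> nonempty_compacts. \<exists>c :: 'a \<Rightarrow> nat. continuous_coloring E k c}"
  have "Polish (subtopology (subtopology vietoris ?S) (?S \<inter> ?C))"
    by (intro Polish_openin Polish_closedin Polish_vietoris closedin_vietoris_sym
        openin_subtopology_Int2 openin_vietoris_colorable)
  moreover have "?S \<inter> (?S \<inter> ?C) = colorable_graphs k" by (auto simp: colorable_graphs_def)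
  ultimately show ?thesis by (simp add: subtopology_subtopology)
qed

lemma chi_c_le_iff: "chi_c E \<le> enat k \<longleftrightarrow> (\<exists>c. continuous_coloring E k c)"
proof
  assume le: "chi_c E \<le> enat k"
  then have ex: "\<exists>k c. continuous_coloring E k c" by (auto simp: chi_c_def split: if_splits)
  let ?m = "LEAST k. \<exists>c. continuous_coloring E k c"
  from ex have "\<exists>c. continuous_coloring E ?m c" by (rule LeastI_ex)
  moreover have "?m \<le> k" using le ex by (simp add: chi_c_def)
  ultimately show "\<exists>c. continuous_coloring E k c"
    unfolding continuous_coloring_def by (meson lessThan_subset_iff subset_trans)
next
  assume ex: "\<exists>c. continuous_coloring E k c"
  then have "(LEAST k. \<exists>c. continuous_coloring E k c) \<le> k" by (rule Least_le)
  then show "chi_c E \<le> enat k" using ex by (auto simp: chi_c_def)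
qed

lemma two_le_chi_c:
  assumes "E \<noteq> {}"
  shows "2 \<le> chi_c E"
proof (rule ccontr)
  assume "\<not> 2 \<le> chi_c E"
  then have "chi_c E \<le> enat 1"
    using ileI1[of "chi_c E" 2] by (cases "chi_c E") (auto simp: numeral_eq_enat)
  then obtain c where "continuous_coloring E 1 c" by (auto simp: chi_c_le_iff)
  then have "c x < 1" "(x, y) \<in> E \<Longrightarrow> c x \<noteq> c y" for x y by (auto simp: continuous_coloring_def)
  then show False using assms by auto
qed

text \<open>A colouring excludes loops, and an edge forces two colours. What remains is
  colourability by k colours, so one argument with parameter k covers this space and
  \<open>C2\<close>.\<close>

lemma C23_eq: "C23 = colorable_graphs 3"
proof -
  have "E \<inter> Id = {}" if "continuous_coloring E k c" for E :: "(cantor \<times> cantor) set" and k c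
    using that by (auto simp: continuous_coloring_def)
  moreover have "chi_c E \<le> 3 \<longleftrightarrow> (\<exists>c. continuous_coloring E 3 c)" for E :: "(cantor \<times> cantor) set"
    using chi_c_le_iff[of E 3] by (simp add: numeral_eq_enat)
  moreover have "2 \<le> chi_c E" if "E \<in> nonempty_compacts" for E :: "(cantor \<times> cantor) set"
    using that by (intro two_le_chi_c) (simp add: nonempty_compacts_def)
  ultimately show ?thesis
    unfolding C23_def colorable_graphs_def by (intro Collect_cong) metis
qed

lemma C2_eq: "C2 = colorable_graphs 2"
proof -
  have "chi_c E = 2 \<longleftrightarrow> chi_c E \<le> 2" if "E \<in> C23" for E
    using that unfolding C23_def by (auto intro: antisym)
  then have "C2 = {E \<in> C23. chi_c E \<le> enat 2}" by (auto simp: C2_def numeral_eq_enat)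
  also have "\<dots> = {E \<in> C23. \<exists>c. continuous_coloring E 2 c}" by (simp only: chi_c_le_iff)
  also have "\<dots> = colorable_graphs 2"
  proof -
    have "continuous_coloring E 3 c" if "continuous_coloring E 2 c"
      for E :: "(cantor \<times> cantor) set" and c
      using that subset_trans[of "range c" "{..<2}" "{..<3}"] by (simp add: continuous_coloring_def)
    then show ?thesis unfolding C23_eq colorable_graphs_def by blast
  qed
  finally show ?thesis .
qed

section \<open>Coding continuous maps\<close>

text \<open>A map into the Cantor space is continuous iff each coordinate is the indicator of a
  clopen set. Listing the indices of these sets parametrizes all continuous maps by the Baire
  space.\<close>

definition cmap :: "(nat \<Rightarrow> nat) \<Rightarrow> 'a :: compact_zero_dim \<Rightarrow> cantor" where
  "cmap \<alpha> x n \<longleftrightarrow> x \<in> clop (\<alpha> n)"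

lemma continuous_on_boolI:
  "open {x. P x} \<Longrightarrow> open {x. \<not> P x} \<Longrightarrow> continuous_on UNIV P"
  using continuous_map_boolI[of euclidean P] by simp

lemma continuous_on_cmap_uncurried:
  "continuous_on UNIV (\<lambda>(\<alpha>, x :: 'a :: compact_zero_dim). cmap \<alpha> x)"
proof (rule continuous_on_coordinatewise_then_product)
  fix n
  have "open {\<alpha> :: nat \<Rightarrow> nat. \<alpha> n = k}" for k
    using open_eval[of "{k}" n] by (simp add: open_discrete)
  then have "open (\<Union>k. {\<alpha> :: nat \<Rightarrow> nat. \<alpha> n = k} \<times> (clop k :: 'a set))"
    and "open (\<Union>k. {\<alpha> :: nat \<Rightarrow> nat. \<alpha> n = k} \<times> (- clop k :: 'a set))"
    by (auto intro!: open_UN open_Times open_Compl)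
  moreover have "(\<Union>k. {\<alpha> :: nat \<Rightarrow> nat. \<alpha> n = k} \<times> (clop k :: 'a set)) = {z. (case z of (\<alpha>, x) \<Rightarrow> cmap \<alpha> x) n}"
    and "(\<Union>k. {\<alpha> :: nat \<Rightarrow> nat. \<alpha> n = k} \<times> (- clop k :: 'a set)) = {z. \<not> (case z of (\<alpha>, x) \<Rightarrow> cmap \<alpha> x) n}"
    by (auto simp: cmap_def)
  ultimately show "continuous_on UNIV (\<lambda>z :: _ \<times> 'a. (case z of (\<alpha>, x) \<Rightarrow> cmap \<alpha> x) n)"
    by (intro continuous_on_boolI) simp_all
qed

lemma continuous_on_cmap_comp [continuous_intros]:
  assumes "continuous_on UNIV f" "continuous_on UNIV g"
  shows "continuous_on UNIV (\<lambda>z. cmap (f z) (g z :: 'a :: compact_zero_dim))"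
  using continuous_on_compose2[OF continuous_on_cmap_uncurried continuous_on_Pair[OF assms]] by simp

lemma ex_cmap:
  fixes f :: "'a :: compact_zero_dim \<Rightarrow> cantor"
  assumes "continuous_on UNIV f"
  obtains \<alpha> where "f = cmap \<alpha>"
proof -
  have "\<exists>k. clop k = {x. f x n}" for n
  proof -
    have "continuous_on UNIV (\<lambda>x. f x n)" using assms by (rule continuous_on_product_then_coordinatewise)
    then have "open ((\<lambda>x. f x n) -` {True})" "closed ((\<lambda>x. f x n) -` {True})"
      by (auto intro!: open_vimage closed_vimage simp: open_discrete)
    then show ?thesis using clop_surj[of "(\<lambda>x. f x n) -` {True}"] by (auto simp: vimage_def)
  qed
  then obtain \<alpha> where "\<And>n. clop (\<alpha> n) = {x. f x n}" by metis
  then have "f = cmap \<alpha>" by (auto simp: fun_eq_iff cmap_def)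
  then show thesis by (rule that)
qed

text \<open>Injectivity makes the images of \<open>{x. x n}\<close> and
  \<open>{x. \<not> x n}\<close> disjoint compact sets, and a clopen set separating them reads off
  bit n. With the left inverse coded, injectivity becomes a closed condition on codes.\<close>

lemma ex_cmap_left_inverse:
  fixes f :: "cantor \<Rightarrow> 'a :: compact_zero_dim"
  assumes f: "continuous_on UNIV f" "inj f"
  obtains \<beta> where "\<And>x. cmap \<beta> (f x) = x"
proof -
  have "\<exists>k. f ` {x. x n} \<subseteq> clop k \<and> clop k \<subseteq> - (f ` {x. \<not> x n})" for n
  proof -
    have "compact {x :: cantor. x n}" "compact {x :: cantor. \<not> x n}"
      by (simp_all add: compact_iff_closed closed_coordinate)
    then have "compact (f ` {x. x n})" "compact (f ` {x. \<not> x n})"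
      by (simp_all add: compact_continuous_image continuous_on_subset[OF f(1)])
    moreover have "f ` {x. x n} \<subseteq> - (f ` {x. \<not> x n})"
      using f(2) by (auto simp: inj_on_def)
    ultimately obtain V where V: "open V" "closed V" "f ` {x. x n} \<subseteq> V" "V \<subseteq> - (f ` {x. \<not> x n})"
      using clopen_between[of "f ` {x. x n}" "- (f ` {x. \<not> x n})"]
      unfolding compact_iff_closed by (metis open_Compl)
    then show ?thesis using clop_surj[OF V(1,2)] by metis
  qed
  then obtain \<beta> where \<beta>: "\<And>n. f ` {x. x n} \<subseteq> clop (\<beta> n) \<and> clop (\<beta> n) \<subseteq> - (f ` {x. \<not> x n})" by metis
  have "cmap \<beta> (f x) n = x n" for x n using \<beta>[of n] unfolding cmap_def by blast
  then have "cmap \<beta> (f x) = x" for x by blast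
  then show thesis by (rule that)
qed

section \<open>The two relations are analytic\<close>

definition chom :: "(nat \<Rightarrow> nat) \<Rightarrow> ('a :: compact_zero_dim \<times> 'a) set \<Rightarrow> (cantor \<times> cantor) set \<Rightarrow> bool" where
  "chom \<alpha> E E' \<longleftrightarrow> (\<forall>(x, y)\<in>E. (cmap \<alpha> x, cmap \<alpha> y) \<in> E')"

text \<open>Suppose an edge (x, y) of E is sent into a clopen V missing E'. By joint continuity of
  \<open>cmap\<close>, codes in some A send all pairs near (x, y) into V. Then codes in A fail for
  all graphs meeting that neighbourhood and all targets missing V.\<close>

lemma closedin_chom:
  "closedin (prod_topology (prod_topology vietoris vietoris) euclidean)
     {((E :: ('a :: compact_zero_dim \<times> 'a) set, E'), \<alpha>). E \<in> nonempty_compacts \<and> E' \<in> nonempty_compacts \<and> chom \<alpha> E E'}"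
    (is "closedin ?Z ?F")
  unfolding closedin_def
proof (intro conjI)
  show "?F \<subseteq> topspace ?Z" by (auto simp: topspace_vietoris)
  show "openin ?Z (topspace ?Z - ?F)"
  proof (subst openin_subopen, intro ballI)
    fix z assume "z \<in> topspace ?Z - ?F"
    then obtain E E' \<alpha> where z: "z = ((E, E'), \<alpha>)" "E \<in> nonempty_compacts" "E' \<in> nonempty_compacts" "\<not> chom \<alpha> E E'"
      by (auto simp: topspace_vietoris)
    then obtain x y where xy: "(x, y) \<in> E" "(cmap \<alpha> x, cmap \<alpha> y) \<notin> E'"
      by (auto simp: chom_def)
    have "open (- E')" using z(3) by (auto simp: nonempty_compacts_def compact_iff_closed)
    then obtain V where V: "open V" "closed V" "(cmap \<alpha> x, cmap \<alpha> y) \<in> V" "V \<subseteq> - E'"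
      using clopen_nbhd xy(2) by blast
    let ?g = "\<lambda>w :: (nat \<Rightarrow> nat) \<times> 'a \<times> 'a. (cmap (fst w) (fst (snd w)), cmap (fst w) (snd (snd w)))"
    have "continuous_on UNIV ?g" by (intro continuous_intros)
    then have "open (?g -` V)" using V(1) by (intro open_vimage)
    moreover have "(\<alpha>, x, y) \<in> ?g -` V" using V(3) by simp
    ultimately obtain A P where AP: "open A" "open P" "(\<alpha>, x, y) \<in> A \<times> P" "A \<times> P \<subseteq> ?g -` V"
      by (rule open_prod_elim)
    let ?T = "({K \<in> nonempty_compacts. K \<inter> P \<noteq> {}} \<times> {K \<in> nonempty_compacts. K \<subseteq> - V}) \<times> A"
    have "openin ?Z ?T"
      using AP V openin_vietoris_meets[of P] openin_vietoris_subset[of "- V"]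
      by (auto simp: openin_prod_Times_iff open_Compl)
    moreover have "z \<in> ?T" using z xy AP V by auto
    moreover have "?T \<subseteq> topspace ?Z - ?F"
    proof
      fix t assume t: "t \<in> ?T"
      then obtain K K' \<gamma> where K: "t = ((K, K'), \<gamma>)" "K \<in> nonempty_compacts" "K' \<in> nonempty_compacts"
          "K \<inter> P \<noteq> {}" "K' \<subseteq> - V" "\<gamma> \<in> A" by auto
      then obtain u v where uv: "(u, v) \<in> K" "(u, v) \<in> P" by auto
      then have "(cmap \<gamma> u, cmap \<gamma> v) \<in> V" using AP(4) K(6) by auto
      then have "\<not> chom \<gamma> K K'" using uv K(5) by (auto simp: chom_def)
      then show "t \<in> topspace ?Z - ?F" using K by (auto simp: topspace_vietoris)
    qed
    ultimately show "\<exists>T. openin ?Z T \<and> z \<in> T \<and> T \<subseteq> topspace ?Z - ?F" by blast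
  qed
qed

lemma closedin_chom_comp:
  fixes a :: "'w :: topological_space \<Rightarrow> nat \<Rightarrow> nat" and p :: "'x \<Rightarrow> ('a :: compact_zero_dim \<times> 'a) set"
  assumes "continuous_map X vietoris p" "continuous_map X vietoris q" "continuous_on UNIV a"
  shows "closedin (prod_topology X euclidean)
    {z \<in> topspace (prod_topology X euclidean). chom (a (snd z)) (p (fst z)) (q (fst z))}"
proof -
  let ?h = "\<lambda>z. ((p (fst z), q (fst z)), a (snd z))"
  have "continuous_map (prod_topology X euclidean) (prod_topology (prod_topology vietoris vietoris) euclidean) ?h"
    using assms by (auto intro!: continuous_map_pairedI
        continuous_map_compose[OF continuous_map_fst, unfolded comp_def]
        continuous_map_compose[OF continuous_map_snd, unfolded comp_def])
  from closedin_continuous_map_preimage[OF this closedin_chom]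
  have "closedin (prod_topology X euclidean) {z \<in> topspace (prod_topology X euclidean).
      ?h z \<in> {((E, E'), \<alpha>). E \<in> nonempty_compacts \<and> E' \<in> nonempty_compacts \<and> chom \<alpha> E E'}}" .
  moreover have "p x \<in> nonempty_compacts" "q x \<in> nonempty_compacts" if "x \<in> topspace X" for x
    using assms(1,2) that by (auto simp: continuous_map_def topspace_vietoris)
  then have "{z \<in> topspace (prod_topology X euclidean).
      ?h z \<in> {((E, E'), \<alpha>). E \<in> nonempty_compacts \<and> E' \<in> nonempty_compacts \<and> chom \<alpha> E E'}} =
      {z \<in> topspace (prod_topology X euclidean). chom (a (snd z)) (p (fst z)) (q (fst z))}"
    by auto
  ultimately show ?thesis by simp
qed

lemma closedin_left_inverse:
  fixes a b :: "'w :: topological_space \<Rightarrow> nat \<Rightarrow> nat"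
  assumes "continuous_on UNIV a" "continuous_on UNIV b"
  shows "closedin (prod_topology X euclidean)
    {z \<in> topspace (prod_topology X euclidean). \<forall>x :: cantor. cmap (b (snd z)) (cmap (a (snd z)) x) = x}"
proof -
  have "closed (\<Inter>x. {w. cmap (b w) (cmap (a w) x) = (x :: cantor)})"
    by (intro closed_INT ballI closed_Collect_eq continuous_intros assms)
  then have "closedin euclidean {w. \<forall>x :: cantor. cmap (b w) (cmap (a w) x) = x}"
    by (simp add: Collect_all_eq)
  from closedin_continuous_map_preimage[OF continuous_map_snd this, of X]
  show ?thesis by simp
qed

lemma analytic_in_projection:
  fixes F :: "('x \<times> 'w :: topological_space) set"
  assumes "Polish X" "Polish (euclidean :: 'w topology)" "closedin (prod_topology X euclidean) F"
  shows "analytic_in X (fst ` F)"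
proof (rule analytic_inI)
  show "Polish_space X" using assms(1) by (rule Polish_imp_Polish_space)
  show "Polish_space (subtopology (prod_topology X euclidean) F)"
    using assms by (intro Polish_imp_Polish_space Polish_closedin Polish_prod_topology)
  show "continuous_map (subtopology (prod_topology X euclidean) F) X fst"
    by (rule continuous_map_subtopology_fst)
  show "fst ` topspace (subtopology (prod_topology X euclidean) F) = fst ` F"
    using closedin_subset[OF assms(3)] by (simp add: Int_absorb1)
qed

lemma in_fst_image: "p \<in> fst ` F \<longleftrightarrow> (\<exists>w. (p, w) \<in> F)"
  by force

type_synonym baire2 = "(nat \<Rightarrow> nat) \<times> (nat \<Rightarrow> nat)"

lemma Polish_baire2: "Polish (euclidean :: baire2 topology)"
  unfolding prod_topology_euclidean[symmetric]
  by (intro Polish_prod_topology Polish_sequences)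

lemma inj_cont_hom_le_iff:
  fixes E E' :: "(cantor \<times> cantor) set"
  shows "E \<preceq>\<^sub>c\<^sup>i E' \<longleftrightarrow> (\<exists>\<alpha> \<beta>. chom \<alpha> E E' \<and> (\<forall>x :: cantor. cmap \<beta> (cmap \<alpha> x) = x))"
proof
  assume "E \<preceq>\<^sub>c\<^sup>i E'"
  then obtain f where f: "inj f" "continuous_on UNIV f" "\<forall>(x, y)\<in>E. (f x, f y) \<in> E'"
    by (auto simp: inj_cont_hom_le_def)
  obtain \<alpha> where \<alpha>: "f = cmap \<alpha>" using ex_cmap[OF f(2)] .
  obtain \<beta> where "\<And>x. cmap \<beta> (f x) = x" using ex_cmap_left_inverse[OF f(2,1)] by blast
  then show "\<exists>\<alpha> \<beta>. chom \<alpha> E E' \<and> (\<forall>x :: cantor. cmap \<beta> (cmap \<alpha> x) = x)"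
    using f(3) \<alpha> by (auto simp: chom_def)
next
  assume "\<exists>\<alpha> \<beta>. chom \<alpha> E E' \<and> (\<forall>x :: cantor. cmap \<beta> (cmap \<alpha> x) = x)"
  then obtain \<alpha> \<beta> where ab: "chom \<alpha> E E'" "\<And>x :: cantor. cmap \<beta> (cmap \<alpha> x) = x" by blast
  have "inj (cmap \<alpha> :: cantor \<Rightarrow> cantor)" using ab(2) by (metis injI)
  moreover have "continuous_on UNIV (cmap \<alpha> :: cantor \<Rightarrow> cantor)" by (intro continuous_intros)
  ultimately show "E \<preceq>\<^sub>c\<^sup>i E'"
    using ab(1) unfolding inj_cont_hom_le_def chom_def by blast
qed

lemma top_graph_iso_iff:
  fixes E E' :: "(cantor \<times> cantor) set"
  shows "E \<cong>\<^sub>t\<^sub>o\<^sub>p E' \<longleftrightarrow> (\<exists>\<alpha> \<beta>. chom \<alpha> E E' \<and> chom \<beta> E' E \<and>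
    (\<forall>x :: cantor. cmap \<beta> (cmap \<alpha> x) = x) \<and> (\<forall>x :: cantor. cmap \<alpha> (cmap \<beta> x) = x))"
proof
  assume "E \<cong>\<^sub>t\<^sub>o\<^sub>p E'"
  then obtain f g where fg: "homeomorphism UNIV UNIV f g" and E: "map_prod f f ` E = E'"
    by (auto simp: top_graph_iso_def)
  then have c: "continuous_on UNIV f" "continuous_on UNIV g" and inv: "\<And>x. g (f x) = x" "\<And>x. f (g x) = x"
    by (auto simp: homeomorphism_def)
  obtain \<alpha> where \<alpha>: "f = cmap \<alpha>" using ex_cmap[OF c(1)] .
  obtain \<beta> where \<beta>: "g = cmap \<beta>" using ex_cmap[OF c(2)] .
  have "chom \<alpha> E E'" "chom \<beta> E' E"
    unfolding chom_def \<alpha>[symmetric] \<beta>[symmetric] E[symmetric] by (force simp: inv)+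
  then show "\<exists>\<alpha> \<beta>. chom \<alpha> E E' \<and> chom \<beta> E' E \<and>
      (\<forall>x :: cantor. cmap \<beta> (cmap \<alpha> x) = x) \<and> (\<forall>x :: cantor. cmap \<alpha> (cmap \<beta> x) = x)"
    using inv unfolding \<alpha> \<beta> by blast
next
  assume "\<exists>\<alpha> \<beta>. chom \<alpha> E E' \<and> chom \<beta> E' E \<and>
    (\<forall>x :: cantor. cmap \<beta> (cmap \<alpha> x) = x) \<and> (\<forall>x :: cantor. cmap \<alpha> (cmap \<beta> x) = x)"
  then obtain \<alpha> \<beta> where ab: "chom \<alpha> E E'" "chom \<beta> E' E" "\<And>x :: cantor. cmap \<beta> (cmap \<alpha> x) = x"
      "\<And>x :: cantor. cmap \<alpha> (cmap \<beta> x) = x" by blast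
  have "continuous_on UNIV (cmap \<gamma> :: cantor \<Rightarrow> cantor)" for \<gamma> by (intro continuous_intros)
  then have "homeomorphism UNIV UNIV (cmap \<alpha> :: cantor \<Rightarrow> cantor) (cmap \<beta>)"
    by (intro homeomorphismI) (auto simp: ab)
  moreover have "map_prod (cmap \<alpha>) (cmap \<alpha>) ` E = E'"
  proof
    show "map_prod (cmap \<alpha>) (cmap \<alpha>) ` E \<subseteq> E'" using ab(1) by (auto simp: chom_def)
    show "E' \<subseteq> map_prod (cmap \<alpha>) (cmap \<alpha>) ` E"
    proof
      fix e assume e: "e \<in> E'"
      then have "map_prod (cmap \<beta>) (cmap \<beta>) e \<in> E" using ab(2) by (auto simp: chom_def)
      moreover have "e = map_prod (cmap \<alpha>) (cmap \<alpha>) (map_prod (cmap \<beta>) (cmap \<beta>) e)"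
        by (cases e) (simp add: ab)
      ultimately show "e \<in> map_prod (cmap \<alpha>) (cmap \<alpha>) ` E" by blast
    qed
  qed
  ultimately show "E \<cong>\<^sub>t\<^sub>o\<^sub>p E'" unfolding top_graph_iso_def by blast
qed

context
  fixes S :: "(cantor \<times> cantor) set set" and G X
  assumes S: "S \<subseteq> nonempty_compacts" and G: "Polish (subtopology vietoris S)"
  defines "G \<equiv> subtopology vietoris S" and "X \<equiv> prod_topology G G"
begin

lemma topspace_graph_pairs: "topspace X = S \<times> S"
  using S by (auto simp: X_def G_def topspace_vietoris)

lemma continuous_map_graph_pairs: "continuous_map X vietoris fst" "continuous_map X vietoris snd"
  using continuous_map_fst[of G G] continuous_map_snd[of G G]
  by (auto simp: X_def G_def continuous_map_in_subtopology)

lemma Polish_graph_pairs: "Polish X"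
  unfolding X_def G_def using G by (simp add: Polish_prod_topology)

lemma analytic_top_graph_iso: "analytic_in X {(E, E'). E \<in> S \<and> E' \<in> S \<and> E \<cong>\<^sub>t\<^sub>o\<^sub>p E'}"
proof -
  let ?T = "topspace (prod_topology X (euclidean :: baire2 topology))"
  let ?F = "{z \<in> ?T. chom (fst (snd z)) (fst (fst z)) (snd (fst z))} \<inter>
    {z \<in> ?T. chom (snd (snd z)) (snd (fst z)) (fst (fst z))} \<inter>
    {z \<in> ?T. \<forall>x :: cantor. cmap (snd (snd z)) (cmap (fst (snd z)) x) = x} \<inter>
    {z \<in> ?T. \<forall>x :: cantor. cmap (fst (snd z)) (cmap (snd (snd z)) x) = x}"
  have "closedin (prod_topology X euclidean) ?F"
    by (intro closedin_Int closedin_chom_comp closedin_left_inverse continuous_map_graph_pairs continuous_intros)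
  then have "analytic_in X (fst ` ?F)"
    by (rule analytic_in_projection[OF Polish_graph_pairs Polish_baire2])
  moreover have "fst ` ?F = {(E, E'). E \<in> S \<and> E' \<in> S \<and> E \<cong>\<^sub>t\<^sub>o\<^sub>p E'}"
  proof (intro equalityI subsetI)
    fix p assume "p \<in> {(E, E'). E \<in> S \<and> E' \<in> S \<and> E \<cong>\<^sub>t\<^sub>o\<^sub>p E'}"
    then obtain E E' \<alpha> \<beta> where "p = (E, E')" "((E, E'), (\<alpha>, \<beta>)) \<in> ?F"
      unfolding top_graph_iso_iff by (auto simp: topspace_graph_pairs)
    then show "p \<in> fst ` ?F" by (simp only: in_fst_image) (rule exI)
  next
    fix p assume "p \<in> fst ` ?F"
    then obtain w where "(p, w) \<in> ?F" unfolding in_fst_image by (rule exE)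
    then show "p \<in> {(E, E'). E \<in> S \<and> E' \<in> S \<and> E \<cong>\<^sub>t\<^sub>o\<^sub>p E'}"
      unfolding top_graph_iso_iff by (cases p, cases w) (simp add: topspace_graph_pairs, blast)
  qed
  ultimately show ?thesis by (simp only:)
qed

lemma analytic_inj_cont_hom_equiv: "analytic_in X {(E, E'). E \<in> S \<and> E' \<in> S \<and> E \<approx>\<^sub>c\<^sup>i E'}"
proof -
  let ?T = "topspace (prod_topology X (euclidean :: (baire2 \<times> baire2) topology))"
  let ?F = "{z \<in> ?T. chom (fst (fst (snd z))) (fst (fst z)) (snd (fst z))} \<inter>
    {z \<in> ?T. \<forall>x :: cantor. cmap (snd (fst (snd z))) (cmap (fst (fst (snd z))) x) = x} \<inter>
    {z \<in> ?T. chom (fst (snd (snd z))) (snd (fst z)) (fst (fst z))} \<inter>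
    {z \<in> ?T. \<forall>x :: cantor. cmap (snd (snd (snd z))) (cmap (fst (snd (snd z))) x) = x}"
  have "closedin (prod_topology X euclidean) ?F"
    by (intro closedin_Int closedin_chom_comp[where a = "\<lambda>w. fst (fst w)"]
        closedin_chom_comp[where a = "\<lambda>w. fst (snd w)"]
        closedin_left_inverse[where a = "\<lambda>w. fst (fst w)" and b = "\<lambda>w. snd (fst w)"]
        closedin_left_inverse[where a = "\<lambda>w. fst (snd w)" and b = "\<lambda>w. snd (snd w)"]
        continuous_map_graph_pairs continuous_intros)
  moreover have "Polish (euclidean :: (baire2 \<times> baire2) topology)"
    unfolding prod_topology_euclidean[symmetric]
    by (intro Polish_prod_topology Polish_sequences)
  ultimately have "analytic_in X (fst ` ?F)"
    by (intro analytic_in_projection Polish_graph_pairs)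
  moreover have "fst ` ?F = {(E, E'). E \<in> S \<and> E' \<in> S \<and> E \<approx>\<^sub>c\<^sup>i E'}"
  proof (intro equalityI subsetI)
    fix p assume "p \<in> {(E, E'). E \<in> S \<and> E' \<in> S \<and> E \<approx>\<^sub>c\<^sup>i E'}"
    then obtain E E' \<alpha> \<beta> \<gamma> \<delta> where "p = (E, E')" "((E, E'), ((\<alpha>, \<beta>), (\<gamma>, \<delta>))) \<in> ?F"
      unfolding inj_cont_hom_equiv_def inj_cont_hom_le_iff by (auto simp: topspace_graph_pairs)
    then show "p \<in> fst ` ?F" by (simp only: in_fst_image) (rule exI)
  next
    fix p assume "p \<in> fst ` ?F"
    then obtain w where "(p, w) \<in> ?F" unfolding in_fst_image by (rule exE)
    then show "p \<in> {(E, E'). E \<in> S \<and> E' \<in> S \<and> E \<approx>\<^sub>c\<^sup>i E'}"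
      unfolding inj_cont_hom_equiv_def inj_cont_hom_le_iff
      by (cases p, cases w) (simp add: topspace_graph_pairs, blast)
  qed
  ultimately show ?thesis by (simp only:)
qed

end

section \<open>A normal form for analytic sets\<close>

text \<open>Finite sequences of naturals are coded by naturals: \<open>0\<close> codes the empty sequence and
  \<open>Suc (prod_encode (m, k))\<close> codes the extension by \<open>k\<close> of the sequence coded by \<open>m\<close>. Thus
  \<open>node \<alpha> j\<close> codes the first \<open>j\<close> values of \<open>\<alpha>\<close>.\<close>

primrec node :: "(nat \<Rightarrow> nat) \<Rightarrow> nat \<Rightarrow> nat" where
  "node \<alpha> 0 = 0"
| "node \<alpha> (Suc j) = Suc (prod_encode (node \<alpha> j, \<alpha> j))"

definition chain :: "nat \<Rightarrow> nat" where "chain n = fst (prod_decode n)"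

lemma chain_prod_encode [simp]: "chain (prod_encode (m, k)) = m"
  by (simp add: chain_def)

lemma chain_le: "chain n \<le> n"
  using le_prod_encode_1[of "fst (prod_decode n)" "snd (prod_decode n)"] by (simp add: chain_def)

lemma node_less: "i < j \<Longrightarrow> node \<alpha> i < node \<alpha> j"
proof (induction j)
  case (Suc j)
  have "node \<alpha> j \<le> prod_encode (node \<alpha> j, \<alpha> j)" by (rule le_prod_encode_1)
  then show ?case using Suc by (cases "i = j") auto
qed simp

lemma node_inj: "node \<alpha> i = node \<alpha> j \<longleftrightarrow> i = j"
  using node_less by (metis linorder_neqE_nat nat_neq_iff)

lemma node_ge: "j \<le> node \<alpha> j"
  using node_less by (intro strict_mono_imp_increasing) (simp add: strict_mono_def)

text \<open>\<open>Suc n\<close> codes a sequence whose initial segment without the last term has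
  code \<open>chain n\<close>. So \<open>cell G m\<close> intersects the sets of G met on the path
  from the empty sequence to m.\<close>

function cell :: "(nat \<Rightarrow> 'a set) \<Rightarrow> nat \<Rightarrow> 'a set" where
  "cell G 0 = UNIV"
| "cell G (Suc n) = cell G (chain n) \<inter> G n"
  by pat_completeness auto
termination
  by (relation "inv_image less_than snd") (auto simp: chain_le less_Suc_eq_le)

text \<open>A Suslin scheme: B is the continuous image of a complete space covered by ever smaller
  balls, and C takes closures of the images of cells. Along a branch the cells shrink to a point z
  by completeness. Continuity of f and the Hausdorff property then force y = f z.\<close>

theorem analytic_in_normal_form:
  assumes "analytic_in Y B"
  obtains C where "\<And>m. closedin Y (C m)"
    and "B = {y \<in> topspace Y. \<exists>\<alpha>. \<forall>j. y \<in> C (node \<alpha> (Suc j))}"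
proof -
  obtain Z :: "nat set topology" and f where Z: "Polish_space Z" "continuous_map Z Y f" "f ` topspace Z = B"
    using assms unfolding analytic_in_def by blast
  have "Hausdorff_space Y"
    using assms unfolding analytic_in_def Polish_space_def
    by (blast intro: completely_metrizable_imp_metrizable_space metrizable_imp_Hausdorff_space)
  obtain M d where Md: "Metric_space M d" "Metric_space.mcomplete M d" "Z = Metric_space.mtopology M d"
    using Z(1) unfolding Polish_space_def completely_metrizable_space_def by blast
  interpret Metric_space M d by (rule Md)
  have tZ: "topspace Z = M" by (simp add: Md)
  have fM: "f z \<in> topspace Y" if "z \<in> M" for z
    using continuous_map_image_subset_topspace[OF Z(2)] that tZ by blast
  obtain D where D: "countable D" "D \<subseteq> M" "mtopology closure_of D = M"
    using Z(1) unfolding Polish_space_def separable_space_def tZ unfolding Md by blast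
  define e where "e = from_nat_into D"
  \<comment> \<open>The radius is computed from the code of the shorter sequence. A code is at least
    the length of its sequence, so the radii tend to 0 along every branch.\<close>
  define G where "G n = mcball (e (snd (prod_decode n))) (inverse (Suc (chain n)))" for n
  define C where "C m = Y closure_of (f ` (M \<inter> cell G m))" for m
  have nested: "cell G (node \<alpha> (Suc j)) = cell G (node \<alpha> j) \<inter> mcball (e (\<alpha> j)) (inverse (Suc (node \<alpha> j)))" for \<alpha> j
    by (simp add: G_def)
  have "closedin Y (C m)" for m by (simp add: C_def)
  moreover have "B = {y \<in> topspace Y. \<exists>\<alpha>. \<forall>j. y \<in> C (node \<alpha> (Suc j))}"
  proof (intro equalityI subsetI)
    fix y assume "y \<in> B"
    then obtain z where z: "z \<in> M" "y = f z" using Z(3) tZ by blast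
    have "\<exists>k. z \<in> mcball (e k) (inverse (Suc m))" for m
    proof -
      have "z \<in> mtopology closure_of D" using D z by simp
      then obtain x where "x \<in> D" "x \<in> mball z (inverse (Suc m))"
        unfolding metric_closure_of by (auto dest: spec[of _ "inverse (real (Suc m))"])
      moreover then obtain k where "e k = x"
        unfolding e_def using from_nat_into_surj[OF D(1)] by blast
      ultimately show ?thesis using D(2) by (intro exI[of _ k]) (auto simp: commute)
    qed
    then obtain a where a: "\<And>m. z \<in> mcball (e (a m)) (inverse (Suc m))" by metis
    \<comment> \<open>The required radius depends on the code reached so far, so the branch is built
      by recursion on codes: \<open>a m\<close> is the term appended to the sequence with code
      m.\<close>
    define s where "s = rec_nat 0 (\<lambda>_ m. Suc (prod_encode (m, a m)))"
    have "node (\<lambda>j. a (s j)) j = s j" for j by (induction j) (auto simp: s_def)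
    moreover have "z \<in> cell G (s j)" for j
      by (induction j) (use a in \<open>auto simp: s_def G_def\<close>)
    ultimately have zc: "z \<in> cell G (node (\<lambda>j. a (s j)) j)" for j by simp
    have "y \<in> C (node (\<lambda>j. a (s j)) (Suc j))" for j
      unfolding C_def z(2)
      by (rule subsetD[OF closure_of_subset]) (use fM z(1) zc[of "Suc j"] in \<open>auto simp del: node.simps cell.simps\<close>)
    moreover have "y \<in> topspace Y" using fM z by simp
    ultimately show "y \<in> {y \<in> topspace Y. \<exists>\<alpha>. \<forall>j. y \<in> C (node \<alpha> (Suc j))}"
      by (intro CollectI conjI exI[of _ "\<lambda>j. a (s j)"]) simp_all
  next
    fix y assume "y \<in> {y \<in> topspace Y. \<exists>\<alpha>. \<forall>j. y \<in> C (node \<alpha> (Suc j))}"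
    then obtain \<alpha> where y: "y \<in> topspace Y" and \<alpha>: "\<And>j. y \<in> C (node \<alpha> (Suc j))" by blast
    define K where "K j = M \<inter> cell G (node \<alpha> (Suc j))" for j
    have KSuc: "K (Suc j) = K j \<inter> mcball (e (\<alpha> (Suc j))) (inverse (Suc (node \<alpha> (Suc j))))" for j
      unfolding K_def nested[of \<alpha> "Suc j"] by blast
    have K0: "K 0 = mcball (e (\<alpha> 0)) (inverse (Suc (node \<alpha> 0)))"
      unfolding K_def nested[of \<alpha> 0] by auto
    have sub: "K j \<subseteq> mcball (e (\<alpha> j)) (inverse (Suc (node \<alpha> j)))" for j
      by (cases j) (auto simp: KSuc K0 simp del: node.simps)
    have closed: "closedin mtopology (K j)" for j
      by (induction j) (auto simp: K0 KSuc)
    have ne: "K j \<noteq> {}" for j using \<alpha>[of j] by (auto simp: C_def K_def)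
    have "decseq K" by (rule decseq_SucI) (auto simp: KSuc)
    moreover have small: "\<exists>j. inverse (real (Suc (node \<alpha> j))) < \<epsilon>" if "\<epsilon> > 0" for \<epsilon>
    proof -
      obtain j where "inverse (real (Suc j)) < \<epsilon>" using reals_Archimedean \<open>\<epsilon> > 0\<close> by blast
      moreover have "inverse (real (Suc (node \<alpha> j))) \<le> inverse (real (Suc j))"
        using node_ge[of j \<alpha>] by (intro le_imp_inverse_le) auto
      ultimately show ?thesis by (intro exI[of _ j]) linarith
    qed
    have "\<forall>\<epsilon>>0. \<exists>n a. K n \<subseteq> mcball a \<epsilon>"
      using small sub by (meson less_imp_le mcball_subset_concentric subset_trans)
    ultimately have "\<Inter> (range K) \<noteq> {}"
      using mcomplete_nest Md(2) closed ne by blast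
    then obtain z where z: "\<And>j. z \<in> K j" by blast
    have zM: "z \<in> M" using z[of 0] by (simp add: K_def)
    have "y = f z"
    proof (rule ccontr)
      assume "y \<noteq> f z"
      moreover have "f z \<in> topspace Y" using fM zM .
      ultimately obtain U V where UV: "openin Y U" "openin Y V" "y \<in> U" "f z \<in> V" "disjnt U V"
        using \<open>Hausdorff_space Y\<close> y unfolding Hausdorff_space_def by metis
      have "openin mtopology {x \<in> M. f x \<in> V}"
        using openin_continuous_map_preimage[OF Z(2) UV(2)] by (simp add: Md)
      then obtain \<epsilon> where \<epsilon>: "\<epsilon> > 0" "mball z \<epsilon> \<subseteq> {x \<in> M. f x \<in> V}"
        using zM UV(4) unfolding openin_mtopology by blast
      obtain j where j: "inverse (real (Suc (node \<alpha> j))) < \<epsilon> / 2" using small \<epsilon>(1) by (meson half_gt_zero)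
      have "K j \<subseteq> mball z \<epsilon>"
      proof
        fix x assume "x \<in> K j"
        then have "d (e (\<alpha> j)) x \<le> inverse (real (Suc (node \<alpha> j)))" "x \<in> M" "e (\<alpha> j) \<in> M"
          using sub[of j] by auto
        moreover have "d (e (\<alpha> j)) z \<le> inverse (real (Suc (node \<alpha> j)))"
          using sub[of j] z[of j] by auto
        ultimately show "x \<in> mball z \<epsilon>"
          using triangle[of z "e (\<alpha> j)" x] j zM commute[of z "e (\<alpha> j)"] by auto
      qed
      then have "f ` K j \<subseteq> V" using \<epsilon>(2) by blast
      moreover obtain x where "x \<in> f ` K j" "x \<in> U"
        using \<alpha>[of j] UV(1,3) unfolding C_def K_def in_closure_of by blast
      ultimately show False using UV(5) by (auto simp: disjnt_def)
    qed
    then show "y \<in> B" using Z(3) zM tZ by blast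
  qed
  ultimately show thesis by (rule that)
qed

section \<open>The graphs\<close>

definition pos :: "nat \<Rightarrow> nat" where "pos n = snd (prod_decode n)"

lemma pos_prod_encode [simp]: "pos (prod_encode (m, k)) = k"
  by (simp add: pos_def)

lemma prod_encode_chain_pos [simp]: "prod_encode (chain n, pos n) = n"
  by (simp add: chain_def pos_def)

lemma prod_encode_0 [simp]: "prod_encode (0, 0) = 0"
  by (simp add: prod_encode_def)

definition right :: "nat \<Rightarrow> nat" where "right n = prod_encode (chain n, Suc (pos n))"
definition left :: "nat \<Rightarrow> nat" where "left n = prod_encode (Suc n, 0)"

lemma chain_right [simp]: "chain (right n) = chain n" and pos_right [simp]: "pos (right n) = Suc (pos n)"
  and chain_left [simp]: "chain (left n) = Suc n" and pos_left [simp]: "pos (left n) = 0"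
  by (simp_all add: right_def left_def)

lemma inj_right: "right n = right n' \<Longrightarrow> n = n'"
  by (metis chain_right pos_right nat.inject prod_encode_chain_pos)

lemma inj_left: "left n = left n' \<Longrightarrow> n = n'"
  by (metis chain_left nat.inject)

lemma left_right_distinct [simp]: "right n \<noteq> n" "n \<noteq> right n" "left n \<noteq> n" "n \<noteq> left n"
  "left n \<noteq> right n" "right n \<noteq> left n"
proof -
  show "right n \<noteq> n" "n \<noteq> right n" by (metis pos_right n_not_Suc_n)+
  have "chain (left n) \<noteq> chain n" using chain_le[of n] by simp
  then show "left n \<noteq> n" "n \<noteq> left n" "left n \<noteq> right n" "right n \<noteq> left n"
    by (metis chain_right)+
qed

text \<open>
  The number \<open>n\<close> stands for the pair \<open>(chain n, pos n)\<close> of a sequence \<open>s\<close> and an index \<open>k\<close>; then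
  \<open>right n\<close> stands for \<open>(s, k + 1)\<close> and \<open>left n\<close> for \<open>(s^k, 0)\<close>. The points \<open>Var n i\<close> form the fibre
  of the variable \<open>n\<close>, the points \<open>Tail m i\<close> the limit fibre of the chain \<open>m\<close>, and \<open>Xor n i j\<close> are the
  gadgets for the equation at \<open>n\<close>. The ray \<open>Pin 0, Link 0, Pin 1, Link 1, \<dots>\<close> holds the fibres in
  place: \<open>Pin (Suc n)\<close> is adjacent to the fibre \<open>n\<close>, \<open>Link n\<close> to the gadgets at \<open>n\<close>, and \<open>Pin 0\<close> to the
  marked points. The points \<open>Origin\<close> and \<open>HubB\<close> are the global limits of the two colour classes;
  \<open>HubB\<close> is adjacent to its whole opposite class, which makes the edge set closed. The flag \<open>r\<close>
  selects the marked point of the root fibre \<open>0\<close>.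
\<close>

datatype vtx = HubA | Origin | Tail nat bool | Var nat bool | Link nat
  | HubB | HubD | Pin nat | Xor nat bool bool

text \<open>Each edge is listed once, from the class of \<open>HubB\<close>. The points
  \<open>Xor n i j\<close> stand for the even triples \<open>(i, j, i \<noteq> j)\<close> on the
  fibres n, \<open>right n\<close> and \<open>left n\<close>; swapping an even number of these
  fibres permutes them. \<open>HubD\<close> singles out the links among the neighbours of a pin.
  \<open>Pin 0\<close> sees \<open>Tail m False\<close> but not \<open>Tail m True\<close>, which
  makes the limit fibres rigid. It also sees every limit of marked points, so that N may be
  arbitrary.\<close>

fun nbrs :: "(nat \<Rightarrow> bool) \<Rightarrow> bool \<Rightarrow> vtx \<Rightarrow> vtx set" where
  "nbrs N r HubB = {HubA, Origin} \<union> {Tail m i | m i. True} \<union> {Var n i | n i. True} \<union> range Link"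
| "nbrs N r HubD = {Origin} \<union> range Link"
| "nbrs N r (Pin 0) = {HubA, Origin, Link 0, Var 0 r} \<union> {Tail m False | m. True} \<union> {Var n False | n. N n}"
| "nbrs N r (Pin (Suc n)) = {HubA, Link n, Link (Suc n), Var n False, Var n True}"
| "nbrs N r (Xor n i j) = {Link n, Var n i, Var (right n) j, Var (left n) (i \<noteq> j)}"
| "nbrs N r _ = {}"

text \<open>Position 0 is the colour class. The least positive position is one more than the region
  m, and growing m forces convergence to \<open>Origin\<close> or \<open>HubB\<close>. In
  \<open>Var n i\<close> the position \<open>chain n + 4 + pos n\<close> runs off to infinity with
  \<open>pos n\<close> and leaves \<open>Tail (chain n) i\<close>. Position 3 tells
  \<open>HubA\<close> from \<open>Link 0\<close> and \<open>HubD\<close> from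
  \<open>Pin 0\<close>.\<close>

fun support :: "vtx \<Rightarrow> nat set" where
  "support HubA = {1, 2, 3}"
| "support Origin = {}"
| "support (Tail m i) = {m + 1} \<union> (if i then {m + 3} else {})"
| "support (Var n i) = {chain n + 1, chain n + 4 + pos n} \<union> (if i then {chain n + 3} else {})"
| "support (Link n) = {n + 1, n + 2}"
| "support HubB = {0}"
| "support HubD = {0, 1, 2, 3}"
| "support (Pin n) = {0, n + 1, n + 2}"
| "support (Xor n i j) = {0, n + 1} \<union> (if i then {n + 3} else {}) \<union> (if j then {n + 4} else {})"

definition pt :: "vtx \<Rightarrow> cantor" where "pt v q \<longleftrightarrow> q \<in> support v"

definition lead :: "cantor \<Rightarrow> nat \<Rightarrow> bool" where
  "lead x m \<longleftrightarrow> x (Suc m) \<and> (\<forall>q<m. \<not> x (Suc q))"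

lemma lead_unique: "lead x m \<Longrightarrow> lead x m' \<Longrightarrow> m = m'"
  unfolding lead_def by (metis linorder_neqE_nat)

fun region :: "vtx \<Rightarrow> nat option" where
  "region HubA = Some 0"
| "region Origin = None"
| "region (Tail m i) = Some m"
| "region (Var n i) = Some (chain n)"
| "region (Link n) = Some n"
| "region HubB = None"
| "region HubD = Some 0"
| "region (Pin n) = Some n"
| "region (Xor n i j) = Some n"

lemma lead_pt: "lead (pt v) m \<longleftrightarrow> region v = Some m"
proof (cases "region v")
  case None
  then have "v = Origin \<or> v = HubB" by (cases v) auto
  then show ?thesis using None by (auto simp: lead_def pt_def)
next
  case (Some l)
  then have "lead (pt v) l" by (cases v) (auto simp: lead_def pt_def)
  then show ?thesis using Some lead_unique by auto
qed

lemma inj_pt: "inj pt"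
proof (rule injI)
  fix u v assume eq: "pt u = pt v"
  have "region u = Some m \<longleftrightarrow> region v = Some m" for m by (simp add: eq flip: lead_pt)
  then have k: "region u = region v" by (metis not_Some_eq)
  have s: "q \<in> support u \<longleftrightarrow> q \<in> support v" for q using eq by (simp add: pt_def fun_eq_iff)
  note s' = s[of 0]
  show "u = v"
  proof (cases u)
    case HubA
    then show ?thesis using k s' s[of 2] s[of 3] by (cases v) (auto split: if_splits)
  next
    case Origin
    then show ?thesis using k s' by (cases v) auto
  next
    case (Tail m i)
    show ?thesis
    proof (cases v)
      case (Var n j)
      then show ?thesis using k s[of "chain n + 4 + pos n"] Tail by (auto split: if_splits)
    qed (use k s' s[of "m + 2"] s[of "m + 3"] Tail in \<open>auto split: if_splits\<close>)
  next
    case (Var n i)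
    show ?thesis
    proof (cases v)
      case (Var n' j)
      have "chain n' = chain n" "pos n' = pos n" "i = j"
        using k s[of "chain n + 4 + pos n"] s[of "chain n + 3"] Var \<open>u = Var n i\<close> by (auto split: if_splits)
      moreover from this have "n' = n" by (metis prod_encode_chain_pos)
      ultimately show ?thesis using Var \<open>u = Var n i\<close> by simp
    qed (use k s' s[of "chain n + 2"] s[of "chain n + 4 + pos n"] Var in \<open>auto split: if_splits\<close>)
  next
    case (Link n)
    then show ?thesis using k s' s[of "n + 2"] s[of "n + 3"] by (cases v) (auto split: if_splits)
  next
    case HubB
    then show ?thesis using k s' by (cases v) (auto split: if_splits)
  next
    case HubD
    then show ?thesis using k s' s[of 2] s[of 3] by (cases v) (auto split: if_splits)
  next
    case (Pin n)
    then show ?thesis using k s' s[of "n + 2"] s[of "n + 3"] by (cases v) (auto split: if_splits)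
  next
    case (Xor n i j)
    then show ?thesis using k s' s[of "n + 2"] s[of "n + 3"] s[of "n + 4"]
      by (cases v) (auto split: if_splits)
  qed
qed

definition half_graph :: "(nat \<Rightarrow> bool) \<Rightarrow> bool \<Rightarrow> (cantor \<times> cantor) set" where
  "half_graph N r = (\<Union>b. {pt b} \<times> pt ` nbrs N r b)"

definition graph :: "(nat \<Rightarrow> bool) \<Rightarrow> bool \<Rightarrow> (cantor \<times> cantor) set" where
  "graph N r = half_graph N r \<union> (half_graph N r)\<inverse>"

subsection \<open>Compactness\<close>

text \<open>A point outside has a clopen neighbourhood V missing L. All but finitely many
  \<open>K n\<close> miss V too, and the rest are closed. The index set I is arbitrary so that the
  marks selected by any N can be added.\<close>

lemma compact_accumulation:
  fixes K :: "nat \<Rightarrow> 'a :: compact_zero_dim set"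
  assumes "compact L" "\<And>n. compact (K n)"
    and acc: "\<And>U. open U \<Longrightarrow> L \<subseteq> U \<Longrightarrow> finite {n. \<not> K n \<subseteq> U}"
  shows "compact (L \<union> (\<Union>n\<in>I. K n))"
proof -
  have "open (- (L \<union> (\<Union>n\<in>I. K n)))"
  proof (subst open_subopen, intro ballI)
    fix x assume x: "x \<in> - (L \<union> (\<Union>n\<in>I. K n))"
    obtain V where V: "open V" "closed V" "x \<in> V" "V \<subseteq> - L"
      using clopen_nbhd[of "- L" x] x assms(1) by (auto simp: compact_iff_closed)
    let ?J = "{n. \<not> K n \<subseteq> - V}"
    have "finite ?J" using V by (intro acc) auto
    then have "open (V \<inter> (\<Inter>n\<in>?J \<inter> I. - K n))"
      using V assms(2) by (intro open_Int open_INT) (auto simp: compact_iff_closed)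
    then show "\<exists>T. open T \<and> x \<in> T \<and> T \<subseteq> - (L \<union> (\<Union>n\<in>I. K n))"
      using V x by (intro exI[of _ "V \<inter> (\<Inter>n\<in>?J \<inter> I. - K n)"]) auto
  qed
  then show ?thesis by (simp add: compact_iff_closed closed_def)
qed

lemma open_prefix:
  assumes "open U" "x \<in> (U :: cantor set)"
  obtains b where "\<And>y. (\<And>q. q < b \<Longrightarrow> y q = x q) \<Longrightarrow> y \<in> U"
proof -
  have "openin (product_topology (\<lambda>_. euclidean) UNIV) U"
    using assms(1) by (simp add: euclidean_product_topology)
  from product_topology_open_contains_basis[OF this assms(2)]
  obtain X where X: "x \<in> Pi\<^sub>E UNIV X" "finite {i. X i \<noteq> UNIV}" "Pi\<^sub>E UNIV X \<subseteq> U"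
    by auto
  obtain b where b: "\<And>i. X i \<noteq> UNIV \<Longrightarrow> i < b"
    using X(2) finite_nat_set_iff_bounded by auto
  show thesis
  proof (rule that[of b])
    fix y assume y: "\<And>q. q < b \<Longrightarrow> y q = x q"
    have "y i \<in> X i" for i using b[of i] y[of i] X(1) by (cases "X i = UNIV") (auto simp: PiE_def)
    then show "y \<in> U" using X(3) by auto
  qed
qed

lemma finite_not_in_nbhd:
  assumes "open U" "x \<in> (U :: cantor set)" "\<And>n y q. y \<in> K n \<Longrightarrow> q < n \<Longrightarrow> y q = x q"
  shows "finite {n :: nat. \<not> K n \<subseteq> U}"
proof -
  obtain b where b: "\<And>y. (\<And>q. q < b \<Longrightarrow> y q = x q) \<Longrightarrow> y \<in> U"
    using open_prefix[OF assms(1,2)] by blast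
  have "{n. \<not> K n \<subseteq> U} \<subseteq> {..<b}"
    using b assms(3) by (auto simp: not_le[symmetric])
  then show ?thesis by (rule finite_subset) simp
qed

lemma compact_sequence:
  assumes "\<And>n. compact (K n)" "\<And>n y q. y \<in> K n \<Longrightarrow> q < n \<Longrightarrow> y q = (x :: cantor) q"
  shows "compact (insert x (\<Union>n. K n))"
  using compact_accumulation[of "{x}" K UNIV] finite_not_in_nbhd[of _ x K] assms by auto

lemma Var_near_Tail: "q < k \<Longrightarrow> pt (Var (prod_encode (m, k)) i) q = pt (Tail m i) q"
  by (auto simp: pt_def)

lemma compact_Tail: "compact (insert (pt (Tail m i)) (\<Union>k. {pt (Var (prod_encode (m, k)) i)}))"
  by (rule compact_sequence) (auto simp: Var_near_Tail)

lemma nbrs_HubB_eq: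
  "pt ` nbrs N r HubB = insert (pt Origin) (\<Union>m. {pt (Link m)} \<union> (if m = 0 then {pt HubA} else {}) \<union>
     (\<Union>i. insert (pt (Tail m i)) (\<Union>k. {pt (Var (prod_encode (m, k)) i)})))"
    (is "_ = ?R")
proof
  show "pt ` nbrs N r HubB \<subseteq> ?R"
  proof (rule image_subsetI)
    fix v assume "v \<in> nbrs N r HubB"
    then consider "v = HubA" | "v = Origin" | m i where "v = Tail m i" | n i where "v = Var n i" | n where "v = Link n"
      by auto
    then show "pt v \<in> ?R"
    proof cases
      case 1
      then show ?thesis by (intro insertI2 UN_I[of 0]) auto
    next
      case (4 n i)
      then have "pt v \<in> (\<Union>k. {pt (Var (prod_encode (chain n, k)) i)})"
        by (intro UN_I[of "pos n"]) auto
      then show ?thesis by blast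
    qed blast+
  qed
  show "?R \<subseteq> pt ` nbrs N r HubB" by (auto split: if_splits)
qed

lemma compact_nbrs_HubB: "compact (pt ` nbrs N r HubB)"
  unfolding nbrs_HubB_eq
proof (rule compact_sequence)
  fix m
  have "compact (\<Union>i. insert (pt (Tail m i)) (\<Union>k. {pt (Var (prod_encode (m, k)) i)}))"
    by (intro compact_UN compact_Tail) simp
  then show "compact ({pt (Link m)} \<union> (if m = 0 then {pt HubA} else {}) \<union>
      (\<Union>i. insert (pt (Tail m i)) (\<Union>k. {pt (Var (prod_encode (m, k)) i)})))"
    by (intro compact_Un) auto
qed (auto simp: pt_def split: if_splits)

lemma compact_nbrs_HubD: "compact (pt ` nbrs N r HubD)"
proof -
  have "compact (insert (pt Origin) (\<Union>n. {pt (Link n)}))"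
    by (rule compact_sequence) (auto simp: pt_def)
  moreover have "pt ` nbrs N r HubD = insert (pt Origin) (\<Union>n. {pt (Link n)})" by auto
  ultimately show ?thesis by simp
qed

lemma compact_nbrs_Pin_0: "compact (pt ` nbrs (\<lambda>_. False) r (Pin 0))"
proof -
  have "compact (insert (pt Origin) (\<Union>m. {pt (Tail m False)}))"
    by (rule compact_sequence) (auto simp: pt_def)
  then have "compact ({pt HubA, pt (Link 0), pt (Var 0 r)} \<union> insert (pt Origin) (\<Union>m. {pt (Tail m False)}))"
    by (intro compact_Un) (auto intro: finite_imp_compact)
  moreover have "pt ` nbrs (\<lambda>_. False) r (Pin 0) =
      {pt HubA, pt (Link 0), pt (Var 0 r)} \<union> insert (pt Origin) (\<Union>m. {pt (Tail m False)})" by auto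
  ultimately show ?thesis by simp
qed

lemma nbrs_subset_HubB: "nbrs N r b \<subseteq> nbrs N r HubB"
  by (induction N r b rule: nbrs.induct) auto

text \<open>The stars centred at \<open>Pin (Suc n)\<close> and \<open>Xor n i j\<close> have
  centres tending to \<open>HubB\<close> and neighbours inside the compact set of neighbours of
  \<open>HubB\<close>. By the tube lemma they accumulate only at the star of
  \<open>HubB\<close>.\<close>

lemma compact_half_graph: "compact (half_graph (\<lambda>_. False) r)"
proof -
  let ?N = "\<lambda>_ :: nat. False"
  let ?S = "\<lambda>b. {pt b} \<times> pt ` nbrs ?N r b"
  define L where "L = ?S HubB \<union> ?S HubD \<union> ?S (Pin 0)"
  define K where "K n = ?S (Pin (Suc n)) \<union> (\<Union>i. \<Union>j. ?S (Xor n i j))" for n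
  have "compact (L \<union> (\<Union>n\<in>UNIV. K n))"
  proof (rule compact_accumulation)
    show "compact L"
      unfolding L_def by (intro compact_Un compact_Times compact_nbrs_HubB compact_nbrs_HubD compact_nbrs_Pin_0) auto
    show "compact (K n)" for n
      unfolding K_def by (intro finite_imp_compact finite_UnI finite_UN_I finite_SigmaI) auto
    fix U :: "(cantor \<times> cantor) set"
    assume U: "open U" "L \<subseteq> U"
    then have "{pt HubB} \<times> pt ` nbrs ?N r HubB \<subseteq> U" by (auto simp: L_def)
    from Elementary_Topology.tube_lemma[OF compact_nbrs_HubB U(1) this]
    obtain W where W: "pt HubB \<in> W" "open W" "W \<times> pt ` nbrs ?N r HubB \<subseteq> U" by blast
    let ?W = "\<lambda>n. {pt (Pin (Suc n))} \<union> (\<Union>i. \<Union>j. {pt (Xor n i j)})"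
    have "finite {n. \<not> ?W n \<subseteq> W}"
      by (rule finite_not_in_nbhd[OF W(2,1)]) (auto simp: pt_def split: if_splits)
    moreover have "K n \<subseteq> U" if "?W n \<subseteq> W" for n
    proof -
      have *: "?S b \<subseteq> U" if "pt b \<in> W" for b
        using W(3) that nbrs_subset_HubB[of ?N r b] by blast
      show ?thesis unfolding K_def by (intro Un_least UN_least *) (use that in auto)
    qed
    then have "{n. \<not> K n \<subseteq> U} \<subseteq> {n. \<not> ?W n \<subseteq> W}" by blast
    ultimately show "finite {n. \<not> K n \<subseteq> U}" by (rule finite_subset[rotated])
  qed
  moreover have "half_graph ?N r = L \<union> (\<Union>n\<in>UNIV. K n)"
  proof
    show "half_graph ?N r \<subseteq> L \<union> (\<Union>n\<in>UNIV. K n)"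
      unfolding half_graph_def
    proof (rule UN_least)
      fix b
      consider "b = HubB" | "b = HubD" | "b = Pin 0" | n where "b = Pin (Suc n)" | n i j where "b = Xor n i j"
        | "nbrs ?N r b = {}" by (cases "(?N, r, b)" rule: nbrs.cases) auto
      then show "?S b \<subseteq> L \<union> (\<Union>n\<in>UNIV. K n)"
      proof cases
        case (4 n)
        then have "?S b \<subseteq> K n" unfolding K_def by blast
        then show ?thesis by blast
      next
        case (5 n i j)
        then have "?S b \<subseteq> K n" unfolding K_def by blast
        then show ?thesis by blast
      qed (auto simp: L_def)
    qed
    show "L \<union> (\<Union>n\<in>UNIV. K n) \<subseteq> half_graph ?N r"
      unfolding L_def K_def half_graph_def by blast
  qed
  ultimately show ?thesis by simp
qed

lemma converse_eq_swap: "R\<inverse> = prod.swap ` R"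
  by force

lemma compact_graph_0: "compact (graph (\<lambda>_. False) r)"
  unfolding graph_def converse_eq_swap
  by (intro compact_Un compact_half_graph compact_continuous_image continuous_on_swap)

section \<open>Dependence of the graph on the forbidden set\<close>

definition mark :: "nat \<Rightarrow> (cantor \<times> cantor) set" where
  "mark n = {(pt (Pin 0), pt (Var n False)), (pt (Var n False), pt (Pin 0))}"

text \<open>Isolates N: a fixed compact graph plus one independent finite piece for each n, switched
  by the bit \<open>N n\<close>.\<close>

lemma graph_eq_marks: "graph N r = graph (\<lambda>_. False) r \<union> (\<Union>n\<in>{n. N n}. mark n)"
proof -
  have "half_graph N r = half_graph (\<lambda>_. False) r \<union> (\<Union>n\<in>{n. N n}. {(pt (Pin 0), pt (Var n False))})"
  proof -
    have "nbrs N r b = nbrs (\<lambda>_. False) r b \<union> (if b = Pin 0 then {Var n False | n. N n} else {})" for b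
      by (induction N r b rule: nbrs.induct) auto
    then have "half_graph N r =
        (\<Union>b. {pt b} \<times> pt ` (nbrs (\<lambda>_. False) r b \<union> (if b = Pin 0 then {Var n False | n. N n} else {})))"
      unfolding half_graph_def by simp
    also have "\<dots> = half_graph (\<lambda>_. False) r \<union>
        (\<Union>b. {pt b} \<times> pt ` (if b = Pin 0 then {Var n False | n. N n} else {}))"
      unfolding half_graph_def by (simp only: image_Un Sigma_Un_distrib2 UN_Un_distrib)
    also have "(\<Union>b. {pt b} \<times> pt ` (if b = Pin 0 then {Var n False | n. N n} else {})) =
        (\<Union>n\<in>{n. N n}. {(pt (Pin 0), pt (Var n False))})"
      by (auto split: if_splits)
    finally show ?thesis .
  qed
  then show ?thesis unfolding graph_def mark_def by auto
qed

text \<open>For all but finitely many chains the whole chain of points \<open>Var n False\<close>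
  lies close to \<open>Origin\<close>. In each remaining chain all but finitely many of them lie
  close to its \<open>Tail m False\<close>. Both limits are neighbours of \<open>Pin 0\<close>
  already.\<close>

lemma marks_accumulate:
  assumes "open U" "graph (\<lambda>_. False) r \<subseteq> U"
  shows "finite {n. \<not> mark n \<subseteq> U}"
proof -
  define W where "W = {x. (pt (Pin 0), x) \<in> U} \<inter> {x. (x, pt (Pin 0)) \<in> U}"
  have "open ((\<lambda>x. (pt (Pin 0), x)) -` U \<inter> (\<lambda>x. (x, pt (Pin 0))) -` U)"
    using assms(1) by (intro open_Int open_vimage continuous_intros)
  then have "open W" by (simp add: W_def vimage_def)
  have W: "pt v \<in> W" if "v \<in> nbrs (\<lambda>_. False) r (Pin 0)" for v
    using that assms(2) unfolding W_def graph_def half_graph_def by blast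
  have "finite {m. \<not> (\<Union>k. {pt (Var (prod_encode (m, k)) False)}) \<subseteq> W}"
    by (rule finite_not_in_nbhd[OF \<open>open W\<close>, of "pt Origin"]) (use W in \<open>auto simp: pt_def\<close>)
  moreover have "finite {k. \<not> {pt (Var (prod_encode (m, k)) False)} \<subseteq> W}" for m
    by (rule finite_not_in_nbhd[OF \<open>open W\<close>, of "pt (Tail m False)"]) (use W Var_near_Tail in auto)
  ultimately have "finite (SIGMA m:{m. \<not> (\<Union>k. {pt (Var (prod_encode (m, k)) False)}) \<subseteq> W}.
      {k. \<not> {pt (Var (prod_encode (m, k)) False)} \<subseteq> W})" (is "finite ?F") by (intro finite_SigmaI)
  moreover have "{n. \<not> mark n \<subseteq> U} \<subseteq> prod_encode ` ?F"
  proof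
    fix n assume "n \<in> {n. \<not> mark n \<subseteq> U}"
    then have "pt (Var (prod_encode (chain n, pos n)) False) \<notin> W" by (auto simp: mark_def W_def)
    then have "(chain n, pos n) \<in> ?F" by (intro SigmaI CollectI) blast+
    then show "n \<in> prod_encode ` ?F" by (intro image_eqI[of _ _ "(chain n, pos n)"]) simp_all
  qed
  ultimately show ?thesis by (meson finite_imageI finite_subset)
qed

lemma graph_nonempty_compact: "graph N r \<in> nonempty_compacts"
proof -
  have "compact (mark n)" for n by (simp add: mark_def finite_imp_compact)
  then have "compact (graph N r)"
    unfolding graph_eq_marks[of N] by (intro compact_accumulation compact_graph_0 marks_accumulate)
  moreover have "(pt HubB, pt HubA) \<in> graph N r" by (auto simp: graph_def half_graph_def)
  ultimately show ?thesis by (auto simp: nonempty_compacts_def)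
qed

text \<open>Containment in an open U depends on finitely many bits of N, because almost all marks
  lie in U once the fixed part does. Meeting U is witnessed by the fixed part or by a single
  mark.\<close>

lemma continuous_map_graph: "continuous_map euclidean vietoris (\<lambda>N. graph N r)"
proof (rule continuous_map_vietorisI)
  define G where "G = graph (\<lambda>_. False) r"
  have eq: "graph N r = G \<union> (\<Union>n\<in>{n. N n}. mark n)" for N
    unfolding G_def by (rule graph_eq_marks)
  fix U :: "(cantor \<times> cantor) set" assume U: "open U"
  show "openin euclidean {N \<in> topspace euclidean. graph N r \<subseteq> U}"
  proof (cases "G \<subseteq> U")
    case True
    have "{N \<in> topspace euclidean. graph N r \<subseteq> U} = (\<Inter>n\<in>{n. \<not> mark n \<subseteq> U}. {N. \<not> N n})"
      using True unfolding eq by auto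
    then show ?thesis
      using marks_accumulate[OF U True[unfolded G_def]] by (auto intro!: open_INT open_coordinate)
  next
    case False
    then have "{N \<in> topspace euclidean. graph N r \<subseteq> U} = {}" unfolding eq by auto
    then show ?thesis by simp
  qed
  have "graph N r \<inter> U \<noteq> {} \<longleftrightarrow> G \<inter> U \<noteq> {} \<or> (\<exists>n. N n \<and> mark n \<inter> U \<noteq> {})" for N
    unfolding eq by blast
  then have "{N \<in> topspace euclidean. graph N r \<inter> U \<noteq> {}} =
      {N. G \<inter> U \<noteq> {}} \<union> (\<Union>n\<in>{n. mark n \<inter> U \<noteq> {}}. {N. N n})"
    by auto
  then show "openin euclidean {N \<in> topspace euclidean. graph N r \<inter> U \<noteq> {}}"
    by (auto intro!: open_Un open_UN open_coordinate open_Collect_const)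
qed (rule graph_nonempty_compact)

lemma graph_in_C2: "graph N r \<in> C2"
proof -
  define c :: "cantor \<Rightarrow> nat" where "c x = of_bool (x 0)" for x
  have "continuous_on UNIV c"
  proof (rule continuous_on_open_vimage[THEN iffD2, OF open_UNIV], intro allI impI)
    fix V :: "nat set"
    have "c -` V \<inter> UNIV = (if 1 \<in> V then {x. x 0} else {}) \<union> (if 0 \<in> V then {x. \<not> x 0} else {})"
      by (auto simp: c_def of_bool_def split: if_splits)
    also have "open \<dots>" by (auto intro!: open_Un open_coordinate)
    finally show "open (c -` V \<inter> UNIV)" .
  qed
  moreover have "c x \<noteq> c y" if xy: "(x, y) \<in> half_graph N r" for x y
  proof -
    obtain a b where "x = pt b" "y = pt a" "a \<in> nbrs N r b" using xy unfolding half_graph_def by blast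
    then show ?thesis by (induction N r b rule: nbrs.induct) (auto simp: c_def pt_def split: if_splits)
  qed
  then have "c x \<noteq> c y" if "(x, y) \<in> graph N r" for x y
    using that unfolding graph_def by (metis UnE converseD)
  moreover have "range c \<subseteq> {..<2}" by (auto simp: c_def)
  ultimately have "continuous_coloring (graph N r) 2 c"
    unfolding continuous_coloring_def by blast
  moreover have "sym (graph N r)" by (simp add: graph_def sym_Un_converse)
  ultimately show ?thesis
    unfolding C2_eq colorable_graphs_def using graph_nonempty_compact by blast
qed

section \<open>Rigidity\<close>

text \<open>The vertices \<open>HubA, HubB, HubD, Pin 0\<close> are the ones of infinite degree, hence are permuted by
  every injective homomorphism; their mutual adjacencies and common neighbours show that each is
  fixed. From there, the ray is fixed step by step.\<close>

definition adj :: "(nat \<Rightarrow> bool) \<Rightarrow> bool \<Rightarrow> vtx \<Rightarrow> vtx \<Rightarrow> bool" where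
  "adj N r u v \<longleftrightarrow> u \<in> nbrs N r v \<or> v \<in> nbrs N r u"

lemma adj_sym: "adj N r u v \<Longrightarrow> adj N r v u"
  by (auto simp: adj_def)

lemma graph_pt_iff: "(pt u, pt v) \<in> graph N r \<longleftrightarrow> adj N r u v"
  using inj_pt by (auto simp: graph_def half_graph_def adj_def inj_def)

lemma graphE:
  assumes "(x, y) \<in> graph N r"
  obtains u v where "x = pt u" "y = pt v" "adj N r u v"
  using assms unfolding graph_def half_graph_def adj_def by blast

lemma adj_right_side:
  assumes "b \<notin> nbrs N r HubB"
  shows "adj N r b u \<longleftrightarrow> u \<in> nbrs N r b"
  using assms nbrs_subset_HubB[of N r u] unfolding adj_def by blast

lemma adj_simps:
  "adj N r HubB u \<longleftrightarrow> u \<in> nbrs N r HubB"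
  "adj N r HubD u \<longleftrightarrow> u = Origin \<or> (\<exists>n. u = Link n)"
  "adj N r (Pin n) u \<longleftrightarrow> u \<in> nbrs N r (Pin n)"
  "adj N r (Xor n i j) u \<longleftrightarrow> u = Link n \<or> u = Var n i \<or> u = Var (right n) j \<or> u = Var (left n) (i \<noteq> j)"
  by (subst adj_right_side; auto)+

lemma adj_left_side:
  "adj N r HubA u \<longleftrightarrow> u = HubB \<or> (\<exists>n. u = Pin n)"
  "adj N r Origin u \<longleftrightarrow> u = HubB \<or> u = HubD \<or> u = Pin 0"
  "adj N r (Tail m i) u \<longleftrightarrow> u = HubB \<or> u = Pin 0 \<and> \<not> i"
  "adj N r (Link n) u \<longleftrightarrow> u = HubB \<or> u = HubD \<or> u = Pin n \<or> u = Pin (Suc n) \<or> (\<exists>i j. u = Xor n i j)"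
  "adj N r (Var n i) u \<longleftrightarrow> u = HubB \<or> u = Pin 0 \<and> (N n \<and> \<not> i \<or> n = 0 \<and> i = r) \<or> u = Pin (Suc n) \<or>
    (\<exists>n' i' j'. u = Xor n' i' j' \<and> (n = n' \<and> i = i' \<or> n = right n' \<and> i = j' \<or> n = left n' \<and> i = (i' \<noteq> j')))"
  unfolding adj_def by (cases "(N, r, u)" rule: nbrs.cases; auto)+

lemma infinite_range_vtx: "infinite (range Link)" "infinite (range Pin)" "infinite (range (\<lambda>m. Tail m i))"
  by (auto intro!: range_inj_infinite injI)

lemma infinite_adj_iff: "infinite {u. adj N r v u} \<longleftrightarrow> v \<in> {HubA, HubB, HubD, Pin 0}"
proof
  assume inf: "infinite {u. adj N r v u}"
  show "v \<in> {HubA, HubB, HubD, Pin 0}"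
  proof (cases v)
    case Origin
    have "{u. adj N r v u} \<subseteq> {HubB, HubD, Pin 0}" by (auto simp: Origin adj_left_side)
    then show ?thesis using inf finite_subset by blast
  next
    case (Tail m i)
    have "{u. adj N r v u} \<subseteq> {HubB, Pin 0}" by (auto simp: Tail adj_left_side)
    then show ?thesis using inf finite_subset by blast
  next
    case (Link n)
    have "{u. adj N r v u} \<subseteq> {HubB, HubD, Pin n, Pin (Suc n)} \<union> (\<Union>i. \<Union>j. {Xor n i j})"
      by (auto simp: Link adj_left_side)
    moreover have "finite (\<Union>i. \<Union>j. {Xor n i j})" by simp
    ultimately show ?thesis using inf finite_subset by (metis finite.emptyI finite.insertI finite_UnI)
  next
    case (Var n i)
    let ?P = "{n} \<union> right -` {n} \<union> left -` {n}"
    have "inj right" "inj left" by (rule injI, erule inj_right inj_left)+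
    then have "finite ?P" by (simp add: finite_vimageI)
    then have "finite ({HubB, Pin 0, Pin (Suc n)} \<union> (\<Union>n'\<in>?P. \<Union>i. \<Union>j. {Xor n' i j}))" by simp
    moreover have "{u. adj N r v u} \<subseteq> {HubB, Pin 0, Pin (Suc n)} \<union> (\<Union>n'\<in>?P. \<Union>i. \<Union>j. {Xor n' i j})"
      by (auto simp: Var adj_left_side)
    ultimately show ?thesis using inf finite_subset by blast
  next
    case (Pin n)
    then show ?thesis using inf by (cases n) (auto simp: adj_simps)
  next
    case (Xor n i j)
    have "{u. adj N r v u} \<subseteq> {Link n, Var n i, Var (right n) j, Var (left n) (i \<noteq> j)}"
      by (auto simp: Xor adj_simps)
    then show ?thesis using inf finite_subset by blast
  qed auto
next
  assume "v \<in> {HubA, HubB, HubD, Pin 0}"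
  then consider "v = HubA" | "v = HubB" | "v = HubD" | "v = Pin 0" by auto
  then show "infinite {u. adj N r v u}"
  proof cases
    case 1
    then have "range Pin \<subseteq> {u. adj N r v u}" by (auto simp: adj_left_side)
    then show ?thesis using infinite_range_vtx infinite_super by blast
  next
    case 2
    then have "range Link \<subseteq> {u. adj N r v u}" by (auto simp: adj_simps)
    then show ?thesis using infinite_range_vtx infinite_super by blast
  next
    case 3
    then have "range Link \<subseteq> {u. adj N r v u}" by (auto simp: adj_simps)
    then show ?thesis using infinite_range_vtx infinite_super by blast
  next
    case 4
    then have "range (\<lambda>m. Tail m False) \<subseteq> {u. adj N r v u}" by (auto simp: adj_simps)
    then show ?thesis using infinite_range_vtx(3)[of False] infinite_super by blast
  qed
qed

text \<open>What an injective continuous homomorphism leaves on vertices: neither surjectivity nor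
  preservation of non-edges. With \<open>N 0\<close> false, \<open>Pin 0\<close> sees exactly one
  point of the root fibre.\<close>

locale marked_hom =
  fixes N :: "nat \<Rightarrow> bool" and \<phi> :: "vtx \<Rightarrow> vtx"
  assumes inj: "inj \<phi>" and hom: "adj N False u v \<Longrightarrow> adj N True (\<phi> u) (\<phi> v)" and N0: "\<not> N 0"
begin

lemma phi_eq_iff [simp]: "\<phi> u = \<phi> v \<longleftrightarrow> u = v"
  using inj by (auto simp: inj_def)

lemma phi_hub:
  assumes "v \<in> {HubA, HubB, HubD, Pin 0}"
  shows "\<phi> v \<in> {HubA, HubB, HubD, Pin 0}"
proof -
  have "infinite (\<phi> ` {u. adj N False v u})"
    using assms inj infinite_adj_iff[of N False v] by (simp add: finite_image_iff inj_on_subset)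
  moreover have "\<phi> ` {u. adj N False v u} \<subseteq> {u. adj N True (\<phi> v) u}" using hom by blast
  ultimately show ?thesis using infinite_adj_iff[of N True "\<phi> v"] infinite_super by blast
qed

text \<open>Among the four hubs adjacency is the path \<open>HubB\<close>, \<open>HubA\<close>,
  \<open>Pin 0\<close>, with \<open>HubD\<close> isolated. Only \<open>HubA\<close> has two
  neighbours that are hubs.\<close>

lemma phi_HubA: "\<phi> HubA = HubA"
proof -
  have "adj N True (\<phi> HubA) (\<phi> HubB)" "adj N True (\<phi> HubA) (\<phi> (Pin 0))"
    by (auto intro!: hom simp: adj_left_side)
  moreover have "\<phi> HubB \<noteq> \<phi> (Pin 0)" by simp
  ultimately show ?thesis
    using phi_hub[of HubA] phi_hub[of HubB] phi_hub[of "Pin 0"] by (auto simp: adj_simps simp del: phi_eq_iff)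
qed

text \<open>\<open>HubD\<close> is the hub left over. \<open>HubB\<close> shares all links with
  \<open>HubD\<close>, whereas \<open>Pin 0\<close> shares only \<open>Link 0\<close> and
  \<open>Origin\<close>, so three links have no room if \<open>HubB\<close> goes to
  \<open>Pin 0\<close>.\<close>

lemma phi_HubB: "\<phi> HubB = HubB" and phi_HubD: "\<phi> HubD = HubD" and phi_Pin_0: "\<phi> (Pin 0) = Pin 0"
proof -
  have "adj N True HubA (\<phi> HubB)" "adj N True HubA (\<phi> (Pin 0))"
    using hom[of HubA HubB] hom[of HubA "Pin 0"] by (auto simp: adj_left_side phi_HubA)
  then have B: "\<phi> HubB \<in> {HubB, Pin 0}" and P: "\<phi> (Pin 0) \<in> {HubB, Pin 0}"
    using phi_hub[of HubB] phi_hub[of "Pin 0"] by (auto simp: adj_left_side)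
  have ne: "\<phi> HubB \<noteq> \<phi> (Pin 0)" "\<phi> HubD \<noteq> \<phi> HubB" "\<phi> HubD \<noteq> \<phi> (Pin 0)" "\<phi> HubD \<noteq> \<phi> HubA" by simp_all
  then show D: "\<phi> HubD = HubD"
    using phi_hub[of HubD] B P phi_HubA by (auto simp del: phi_eq_iff)
  show "\<phi> HubB = HubB"
  proof (rule ccontr)
    assume "\<phi> HubB \<noteq> HubB"
    then have B: "\<phi> HubB = Pin 0" using B by auto
    have "\<phi> (Link n) \<in> {Link 0, Origin}" for n
    proof -
      have "adj N True (Pin 0) (\<phi> (Link n))" "adj N True HubD (\<phi> (Link n))"
        using hom[of HubB "Link n"] hom[of HubD "Link n"] B D by (auto simp: adj_simps)
      then show ?thesis by (auto simp: adj_simps)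
    qed
    from this[of 0] this[of 1] this[of 2] show False
      using phi_eq_iff[of "Link 0" "Link 1"] phi_eq_iff[of "Link 0" "Link 2"] phi_eq_iff[of "Link 1" "Link 2"]
      by (auto simp del: phi_eq_iff)
  qed
  then show "\<phi> (Pin 0) = Pin 0" using P ne by (auto simp del: phi_eq_iff)
qed

lemmas phi_hubs = phi_HubA phi_HubB phi_HubD phi_Pin_0

text \<open>The only rival is \<open>Origin\<close>, whose neighbours are fixed hubs and hence leave
  no image for \<open>Pin 1\<close>.\<close>

lemma phi_Link_0: "\<phi> (Link 0) = Link 0"
proof -
  have "adj N True (Pin 0) (\<phi> (Link 0))" "adj N True HubD (\<phi> (Link 0))"
    using hom[of "Pin 0" "Link 0"] hom[of HubD "Link 0"] by (auto simp: adj_simps phi_hubs)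
  then have "\<phi> (Link 0) = Link 0 \<or> \<phi> (Link 0) = Origin" by (auto simp: adj_simps)
  moreover have "\<phi> (Link 0) \<noteq> Origin"
  proof
    assume "\<phi> (Link 0) = Origin"
    then have "\<phi> (Pin 1) \<in> {HubB, HubD, Pin 0}"
      using hom[of "Link 0" "Pin 1"] by (auto simp: adj_left_side)
    then show False
      using phi_eq_iff[of "Pin 1" HubB] phi_eq_iff[of "Pin 1" HubD] phi_eq_iff[of "Pin 1" "Pin 0"]
      by (auto simp: phi_hubs simp del: phi_eq_iff)
  qed
  ultimately show ?thesis by blast
qed

text \<open>\<open>Pin (Suc n)\<close> goes to a common neighbour of \<open>Link n\<close> and
  \<open>HubA\<close>, then \<open>Link (Suc n)\<close> to one of \<open>Pin (Suc n)\<close> and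
  \<open>HubD\<close>. All candidates but one are already taken.\<close>

lemma phi_spine: "\<phi> (Pin n) = Pin n \<and> \<phi> (Link n) = Link n"
proof (induction n)
  case 0
  then show ?case by (simp add: phi_Link_0 phi_Pin_0)
next
  case (Suc n)
  have "adj N True (Link n) (\<phi> (Pin (Suc n)))" "adj N True HubA (\<phi> (Pin (Suc n)))"
    using hom[of "Link n" "Pin (Suc n)"] hom[of HubA "Pin (Suc n)"] Suc
    by (auto simp: adj_left_side phi_hubs)
  then have "\<phi> (Pin (Suc n)) \<in> {HubB, Pin n, Pin (Suc n)}" by (auto simp: adj_left_side)
  then have P: "\<phi> (Pin (Suc n)) = Pin (Suc n)"
    using phi_eq_iff[of "Pin (Suc n)" HubB] phi_eq_iff[of "Pin (Suc n)" "Pin n"] Suc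
    by (auto simp: phi_hubs simp del: phi_eq_iff)
  have "adj N True (Pin (Suc n)) (\<phi> (Link (Suc n)))" "adj N True HubD (\<phi> (Link (Suc n)))"
    using hom[of "Pin (Suc n)" "Link (Suc n)"] hom[of HubD "Link (Suc n)"] P
    by (auto simp: adj_simps phi_hubs)
  then have "\<phi> (Link (Suc n)) \<in> {Link n, Link (Suc n)}" by (auto simp: adj_simps)
  then have "\<phi> (Link (Suc n)) = Link (Suc n)"
    using phi_eq_iff[of "Link (Suc n)" "Link n"] Suc by (auto simp del: phi_eq_iff)
  with P show ?case by simp
qed

lemma phi_Var_fiber: "\<phi> (Var n i) \<in> {Var n False, Var n True}"
proof -
  have "adj N True (Pin (Suc n)) (\<phi> (Var n i))"
    using hom[of "Pin (Suc n)" "Var n i"] phi_spine[of "Suc n"] by (cases i) (auto simp: adj_simps)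
  then have "\<phi> (Var n i) \<in> {HubA, Link n, Link (Suc n), Var n False, Var n True}" by (simp add: adj_simps)
  then show ?thesis
    using phi_eq_iff[of "Var n i" HubA] phi_eq_iff[of "Var n i" "Link n"] phi_eq_iff[of "Var n i" "Link (Suc n)"]
      phi_spine[of n] phi_spine[of "Suc n"] by (auto simp: phi_hubs simp del: phi_eq_iff)
qed

definition flips :: "nat \<Rightarrow> bool" where
  "flips n \<longleftrightarrow> \<phi> (Var n False) = Var n True"

lemma phi_Var: "\<phi> (Var n i) = Var n (i \<noteq> flips n)"
  using phi_Var_fiber[of n False] phi_Var_fiber[of n True] phi_eq_iff[of "Var n False" "Var n True"]
  unfolding flips_def by (cases i) (auto simp del: phi_eq_iff)

lemma phi_Xor_fiber: "\<exists>i' j'. \<phi> (Xor n i j) = Xor n i' j'"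
proof -
  have "adj N False (Link n) (Xor n i j)" by (simp add: adj_left_side)
  from hom[OF this] have "adj N True (Link n) (\<phi> (Xor n i j))" using phi_spine[of n] by simp
  moreover have "\<phi> (Xor n i j) \<noteq> \<phi> HubB" "\<phi> (Xor n i j) \<noteq> \<phi> HubD" "\<phi> (Xor n i j) \<noteq> \<phi> (Pin n)"
    "\<phi> (Xor n i j) \<noteq> \<phi> (Pin (Suc n))" by simp_all
  ultimately show ?thesis
    unfolding adj_left_side phi_hubs conjunct1[OF phi_spine] by blast
qed

text \<open>One gadget point suffices: the image of the triple of three zeros is again an even
  triple, and its entries are the three flips.\<close>

lemma flips_xor: "flips (left n) \<longleftrightarrow> flips n \<noteq> flips (right n)"
proof -
  obtain i j where ij: "\<phi> (Xor n False False) = Xor n i j" using phi_Xor_fiber by blast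
  have "adj N True (Xor n i j) (\<phi> (Var n False))" "adj N True (Xor n i j) (\<phi> (Var (right n) False))"
    "adj N True (Xor n i j) (\<phi> (Var (left n) False))"
    unfolding ij[symmetric] by (auto intro!: hom simp: adj_simps)
  then show ?thesis by (auto simp: adj_simps phi_Var)
qed

lemma flips_marked: "N n \<Longrightarrow> \<not> flips n"
proof
  assume n: "N n" "flips n"
  then have "adj N True (Pin 0) (Var n True)"
    using hom[of "Pin 0" "Var n False"] by (auto simp: adj_simps phi_hubs phi_Var)
  then show False using n N0 by (auto simp: adj_simps)
qed

lemma flips_0: "flips 0"
proof -
  have "adj N True (Pin 0) (Var 0 (flips 0))"
    using hom[of "Pin 0" "Var 0 False"] by (auto simp: adj_simps phi_hubs phi_Var)
  then show ?thesis using N0 by (auto simp: adj_simps)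
qed

text \<open>The limit points are not shown to be fixed. This exclusion is all that the continuity
  argument needs.\<close>

lemma phi_Tail: "\<phi> (Tail m False) \<noteq> Tail l True"
proof
  assume "\<phi> (Tail m False) = Tail l True"
  then have "adj N True (Pin 0) (Tail l True)"
    using hom[of "Pin 0" "Tail m False"] by (auto simp: adj_simps phi_hubs)
  then show False by (auto simp: adj_simps)
qed

text \<open>If no extension of m by one term were flipped, the equations would make
  \<open>flips\<close> constant along the chain m, hence true throughout, against
  finiteness.\<close>

lemma flips_branch:
  assumes "\<And>m. finite {k. flips (prod_encode (m, k))}"
  obtains \<alpha> where "\<And>j. flips (prod_encode (node \<alpha> j, 0))"
proof -
  have step: "\<exists>k. flips (prod_encode (Suc (prod_encode (m, k)), 0))" if m: "flips (prod_encode (m, 0))" for m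
  proof (rule ccontr)
    assume "\<not> ?thesis"
    then have "flips (prod_encode (m, Suc k)) = flips (prod_encode (m, k))" for k
      using flips_xor[of "prod_encode (m, k)"] by (simp add: left_def right_def)
    then have "flips (prod_encode (m, k))" for k using m by (induction k) auto
    then have "{k. flips (prod_encode (m, k))} = UNIV" by auto
    then show False using assms[of m] by simp
  qed
  define a where "a m = (SOME k. flips (prod_encode (Suc (prod_encode (m, k)), 0)))" for m
  define s where "s = rec_nat 0 (\<lambda>_ m. Suc (prod_encode (m, a m)))"
  have node: "node (\<lambda>j. a (s j)) j = s j" for j by (induction j) (auto simp: s_def)
  have "flips (prod_encode (s j, 0))" for j
  proof (induction j)
    case 0
    then show ?case using flips_0 by (simp add: s_def)
  next
    case (Suc j)
    from someI_ex[OF step[OF this]] show ?case by (simp add: s_def a_def)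
  qed
  then show thesis using that[of "\<lambda>j. a (s j)"] by (simp add: node)
qed

end

theorem hom_imp_branch:
  assumes le: "graph N False \<preceq>\<^sub>c\<^sup>i graph N True" and N0: "\<not> N 0"
  obtains \<alpha> where "\<And>j. \<not> N (prod_encode (node \<alpha> j, 0))"
proof -
  obtain f where f: "inj f" "continuous_on UNIV f" "\<And>x y. (x, y) \<in> graph N False \<Longrightarrow> (f x, f y) \<in> graph N True"
    using le by (auto simp: inj_cont_hom_le_def)
  \<comment> \<open>No vertex is isolated, so \<open>f (pt u)\<close> is an endpoint of an edge, and
    edges only join points of the form \<open>pt v\<close>.\<close>
  have "\<exists>v. f (pt u) = pt v" for u
  proof -
    have "adj N False (Pin n) HubA" for n
      by (rule adj_sym) (simp add: adj_left_side)
    then have "adj N False u (case u of HubB \<Rightarrow> HubA | HubD \<Rightarrow> Origin | Pin n \<Rightarrow> HubA | Xor n i j \<Rightarrow> Link n | _ \<Rightarrow> HubB)"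
      by (cases u) (auto simp: adj_left_side adj_simps)
    then obtain v where "(pt u, pt v) \<in> graph N False" using graph_pt_iff by blast
    then show ?thesis using f(3) graphE by metis
  qed
  then obtain \<phi> where \<phi>: "\<And>u. f (pt u) = pt (\<phi> u)" by metis
  interpret marked_hom N \<phi>
  proof
    show "inj \<phi>" using f(1) inj_pt \<phi> by (metis inj_def)
    show "adj N True (\<phi> u) (\<phi> v)" if "adj N False u v" for u v
      using that f(3) by (metis graph_pt_iff \<phi>)
  qed (rule N0)
  have "finite {k. flips (prod_encode (m, k))}" for m
  proof (rule ccontr)
    assume inf: "infinite {k. flips (prod_encode (m, k))}"
    \<comment> \<open>Infinitely many flips in the chain m would give images tending both to
      \<open>Tail m True\<close> and, by continuity, to the image of \<open>Tail m False\<close>. A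
      single coordinate q where these differ yields the contradiction.\<close>
    have "f (pt (Tail m False)) \<noteq> pt (Tail m True)"
      using phi_Tail inj_pt by (auto simp: \<phi> inj_def)
    then obtain q where q: "f (pt (Tail m False)) q \<noteq> pt (Tail m True) q" by blast
    define W where "W = f -` {y. y q = f (pt (Tail m False)) q}"
    have "open {y :: cantor. y q = f (pt (Tail m False)) q}"
      by (cases "f (pt (Tail m False)) q") (simp_all add: open_coordinate)
    then have "open W" unfolding W_def by (rule open_vimage[OF _ f(2)])
    then have "finite {k. \<not> {pt (Var (prod_encode (m, k)) False)} \<subseteq> W}"
      by (rule finite_not_in_nbhd[of _ "pt (Tail m False)"]) (auto simp: W_def Var_near_Tail)
    then have "infinite ({k. flips (prod_encode (m, k))} - ({k. \<not> {pt (Var (prod_encode (m, k)) False)} \<subseteq> W} \<union> {..q}))"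
      using inf by (intro Diff_infinite_finite) auto
    then obtain k where "k \<in> {k. flips (prod_encode (m, k))} - ({k. \<not> {pt (Var (prod_encode (m, k)) False)} \<subseteq> W} \<union> {..q})"
      using infinite_imp_nonempty by blast
    then have k: "flips (prod_encode (m, k))" "pt (Var (prod_encode (m, k)) False) \<in> W" "q < k" by auto
    then have "f (pt (Var (prod_encode (m, k)) False)) q = f (pt (Tail m False)) q" by (simp add: W_def)
    then have "pt (Var (prod_encode (m, k)) True) q = f (pt (Tail m False)) q"
      using k(1) by (simp add: \<phi> phi_Var)
    then show False using q Var_near_Tail[OF k(3), of m True] by simp
  qed
  from flips_branch[OF this] obtain \<alpha> where "\<And>j. flips (prod_encode (node \<alpha> j, 0))" by blast
  then show thesis using that flips_marked by blast
qed

section \<open>A branch yields an isomorphism\<close>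

fun move :: "(nat \<Rightarrow> bool) \<Rightarrow> vtx \<Rightarrow> vtx" where
  "move F (Var n i) = Var n (i \<noteq> F n)"
| "move F (Xor n i j) = Xor n (i \<noteq> F n) (j \<noteq> F (right n))"
| "move F v = v"

text \<open>The point \<open>Var n i\<close> stores \<open>i\<close> at position \<open>chain n + 3\<close> and \<open>pos n\<close> in unary from position
  \<open>chain n + 4\<close> on; \<open>Xor n i j\<close> stores \<open>i\<close> and \<open>j\<close> at positions \<open>n + 3\<close> and \<open>n + 4\<close>. The bit at
  position \<open>chain n + 2\<close>, respectively \<open>n + 2\<close>, tells them from the points that do not move.\<close>

definition flip_at :: "(nat \<Rightarrow> bool) \<Rightarrow> cantor \<Rightarrow> nat \<Rightarrow> bool" where
  "flip_at F x q \<longleftrightarrow> (\<exists>m. lead x m \<and> \<not> x (m + 2) \<and>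
     (if x 0 then q = m + 3 \<and> F m \<or> q = m + 4 \<and> F (right m)
      else q = m + 3 \<and> (\<exists>k. F (prod_encode (m, k)) \<and> x (m + 4 + k) \<and> (\<forall>j<k. \<not> x (m + 4 + j)))))"

text \<open>Extends \<open>move F\<close> to the whole Cantor space by a rule on bits that makes
  sense at every point, coded or not.\<close>

definition move_pt :: "(nat \<Rightarrow> bool) \<Rightarrow> cantor \<Rightarrow> cantor" where
  "move_pt F x q \<longleftrightarrow> x q \<noteq> flip_at F x q"

lemma move_pt_pt: "move_pt F (pt v) = pt (move F v)"
proof
  fix q
  show "move_pt F (pt v) q = pt (move F v) q"
  proof (cases v)
    case (Var n i)
    have p: "\<not> pt v 0" "\<not> pt v (chain n + 2)" "pt v (chain n + 4 + k) \<longleftrightarrow> k = pos n" for k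
      by (auto simp: Var pt_def split: if_splits)
    have "flip_at F (pt v) q \<longleftrightarrow> q = chain n + 3 \<and> F n"
      unfolding flip_at_def lead_pt using p by (auto simp: Var)
    then show ?thesis by (auto simp: move_pt_def Var pt_def)
  next
    case (Xor n i j)
    have p: "pt v 0" "\<not> pt v (n + 2)" by (auto simp: Xor pt_def split: if_splits)
    have "flip_at F (pt v) q \<longleftrightarrow> q = n + 3 \<and> F n \<or> q = n + 4 \<and> F (right n)"
      unfolding flip_at_def lead_pt using p by (auto simp: Xor)
    then show ?thesis by (auto simp: move_pt_def Xor pt_def)
  qed (auto simp: move_pt_def flip_at_def lead_pt, auto simp: pt_def split: if_splits)
qed

lemma lead_move_pt: "lead (move_pt F x) m \<longleftrightarrow> lead x m"
proof -
  have *: "lead (move_pt F x) m" if m: "lead x m" for m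
  proof -
    have "move_pt F x q \<longleftrightarrow> x q" if "q \<le> Suc m" for q
      using that lead_unique[OF m] unfolding move_pt_def flip_at_def by (auto split: if_splits)
    then show ?thesis using m unfolding lead_def by auto
  qed
  show ?thesis
  proof
    assume m: "lead (move_pt F x) m"
    show "lead x m"
    proof (cases "\<exists>l. lead x l")
      case True
      then show ?thesis using * m lead_unique by blast
    next
      case False
      then have "move_pt F x = x" by (auto simp: move_pt_def flip_at_def fun_eq_iff)
      then show ?thesis using m by simp
    qed
  qed (rule *)
qed

text \<open>The bits that decide about flipping are never the flipped ones: for colour 0 only
  position m + 3 changes, and for colour 1, where m + 4 may change too, the positions from m + 4 on
  are not consulted.\<close>

lemma flip_at_move_pt: "flip_at F (move_pt F x) q \<longleftrightarrow> flip_at F x q"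
proof (cases "\<exists>m. lead x m")
  case True
  then obtain m where m: "lead x m" by blast
  have unf: "flip_at F y q \<longleftrightarrow> \<not> y (m + 2) \<and>
     (if y 0 then q = m + 3 \<and> F m \<or> q = m + 4 \<and> F (right m)
      else q = m + 3 \<and> (\<exists>k. F (prod_encode (m, k)) \<and> y (m + 4 + k) \<and> (\<forall>j<k. \<not> y (m + 4 + j))))"
    if "lead y m" for y q
    using that lead_unique unfolding flip_at_def by blast
  have eq: "move_pt F x q \<longleftrightarrow> x q" if "q \<noteq> m + 3" "q \<noteq> m + 4 \<or> \<not> x 0" for q
    using that unfolding move_pt_def unf[OF m] by (auto split: if_splits)
  have "lead (move_pt F x) m" using m by (simp add: lead_move_pt)
  moreover have "move_pt F x (m + 2) = x (m + 2)" "move_pt F x 0 = x 0" using eq by auto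
  moreover have "move_pt F x (m + 4 + k) = x (m + 4 + k)" if "\<not> x 0" for k using eq that by auto
  ultimately show ?thesis unfolding unf[OF m] by (simp add: unf)
next
  case False
  then show ?thesis by (simp add: flip_at_def lead_move_pt)
qed

lemma move_pt_involution: "move_pt F (move_pt F x) = x"
proof
  show "move_pt F (move_pt F x) q = x q" for q
    unfolding move_pt_def[of F "move_pt F x"] flip_at_move_pt by (auto simp: move_pt_def)
qed

lemma open_finite_dependence:
  assumes "\<And>x y :: cantor. (\<And>i. i < b \<Longrightarrow> x i = y i) \<Longrightarrow> P x = P y"
  shows "open {x. P x}"
proof (subst open_subopen, intro ballI)
  fix x assume x: "x \<in> {x. P x}"
  have "open {y :: cantor. y i = x i}" for i
    by (cases "x i") (simp_all add: open_coordinate)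
  then have "open (\<Inter>i\<in>{..<b}. {y. y i = x i})" by (intro open_INT) auto
  moreover have "P y" if "y \<in> (\<Inter>i\<in>{..<b}. {y. y i = x i})" for y
    using assms[of x y] that x by simp
  then have "(\<Inter>i\<in>{..<b}. {y. y i = x i}) \<subseteq> {x. P x}" by blast
  ultimately show "\<exists>T. open T \<and> x \<in> T \<and> T \<subseteq> {x. P x}"
    by (intro exI[of _ "\<Inter>i\<in>{..<b}. {y. y i = x i}"]) auto
qed

text \<open>Coordinate q is affected only through regions m with m + 3 \<le> q, and by finiteness
  there is a common bound b on the k with \<open>F (prod_encode (m, k))\<close> in these chains. So
  the search for k reads a bounded prefix, for which q + b + 5 leaves some slack.\<close>

lemma continuous_on_move_pt:
  assumes "\<And>m. finite {k. F (prod_encode (m, k))}"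
  shows "continuous_on UNIV (move_pt F)"
proof (rule continuous_on_coordinatewise_then_product)
  fix q
  have "finite (\<Union>m\<in>{..q}. {k. F (prod_encode (m, k))})" using assms by blast
  then obtain b where "\<forall>k\<in>(\<Union>m\<in>{..q}. {k. F (prod_encode (m, k))}). k < b"
    unfolding finite_nat_set_iff_bounded by blast
  then have b: "k < b" if "m \<le> q" "F (prod_encode (m, k))" for m k using that by auto
  have dep: "move_pt F x q = move_pt F y q" if xy: "\<And>i. i < q + b + 5 \<Longrightarrow> x i = y i" for x y
  proof -
    have imp: "flip_at F y q" if "flip_at F x q" and xy: "\<And>i. i < q + b + 5 \<Longrightarrow> x i = y i" for x y
    proof -
      obtain m where m: "lead x m" "\<not> x (m + 2)" "if x 0 then q = m + 3 \<and> F m \<or> q = m + 4 \<and> F (right m)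
          else q = m + 3 \<and> (\<exists>k. F (prod_encode (m, k)) \<and> x (m + 4 + k) \<and> (\<forall>j<k. \<not> x (m + 4 + j)))"
        using \<open>flip_at F x q\<close> unfolding flip_at_def by blast
      then have mq: "m + 3 \<le> q" by (auto split: if_splits)
      then have "lead y m" using m(1) xy by (auto simp: lead_def)
      moreover have "\<not> y (m + 2)" "y 0 = x 0" using m(2) xy mq by auto
      moreover have "y (m + 4 + k) \<and> (\<forall>j<k. \<not> y (m + 4 + j))"
        if "F (prod_encode (m, k))" "x (m + 4 + k) \<and> (\<forall>j<k. \<not> x (m + 4 + j))" for k
      proof -
        have "k < b" using b[of m k] that(1) mq by simp
        then show ?thesis using that(2) xy[of "m + 4 + j" for j] mq by auto
      qed
      ultimately show ?thesis using m(3) unfolding flip_at_def by (intro exI[of _ m]) (auto split: if_splits)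
    qed
    have "flip_at F x q = flip_at F y q" using imp[of x y] imp[of y x] xy by auto
    then show ?thesis using xy[of q] by (simp add: move_pt_def)
  qed
  have dep': "(\<not> move_pt F x q) = (\<not> move_pt F y q)" if "\<And>i. i < q + b + 5 \<Longrightarrow> x i = y i" for x y
    by (rule arg_cong[OF dep[OF that]])
  show "continuous_on UNIV (\<lambda>x. move_pt F x q)"
    using open_finite_dependence[OF dep] open_finite_dependence[OF dep'] by (rule continuous_on_boolI)
qed

text \<open>For a gadget the third entry becomes
  \<open>(i \<noteq> F n) \<noteq> (j \<noteq> F (right n))\<close>, which the equation turns into
  \<open>(i \<noteq> j) \<noteq> F (left n)\<close>. At \<open>Pin 0\<close>, the flip of the root
  fibre exchanges the two root marks, while forbidden fibres stay.\<close>

lemma move_nbrs: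
  assumes "F 0" "\<And>n. F (left n) \<longleftrightarrow> F n \<noteq> F (right n)" "\<And>n. N n \<Longrightarrow> \<not> F n" "a \<in> nbrs N r b"
  shows "move F a \<in> nbrs N (\<not> r) (move F b)"
  using assms by (cases "(N, r, b)" rule: nbrs.cases) auto

lemma flips_imp_iso:
  assumes F: "F 0" "\<And>n. F (left n) \<longleftrightarrow> F n \<noteq> F (right n)" "\<And>n. N n \<Longrightarrow> \<not> F n"
    and fin: "\<And>m. finite {k. F (prod_encode (m, k))}"
  shows "graph N False \<cong>\<^sub>t\<^sub>o\<^sub>p graph N True"
proof -
  have hom: "(move_pt F x, move_pt F y) \<in> graph N (\<not> r)" if xy: "(x, y) \<in> graph N r" for x y r
  proof -
    obtain u v where uv: "x = pt u" "y = pt v" "adj N r u v" using xy by (rule graphE)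
    then have "adj N (\<not> r) (move F u) (move F v)"
      using move_nbrs[OF F] by (auto simp: adj_def)
    then show ?thesis by (simp add: uv move_pt_pt graph_pt_iff)
  qed
  have "homeomorphism UNIV UNIV (move_pt F) (move_pt F)"
    by (intro homeomorphismI continuous_on_move_pt fin) (auto simp: move_pt_involution)
  moreover have "map_prod (move_pt F) (move_pt F) ` graph N False = graph N True"
  proof (intro equalityI subsetI)
    fix e assume "e \<in> map_prod (move_pt F) (move_pt F) ` graph N False"
    then show "e \<in> graph N True" using hom[of _ _ False] by auto
  next
    fix e assume "e \<in> graph N True"
    then have "map_prod (move_pt F) (move_pt F) e \<in> graph N False" using hom[of "fst e" "snd e" True] by (cases e) auto
    then show "e \<in> map_prod (move_pt F) (move_pt F) ` graph N False"
      by (intro image_eqI[of _ _ "map_prod (move_pt F) (move_pt F) e"]) (cases e; simp add: move_pt_involution)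
  qed
  ultimately show ?thesis unfolding top_graph_iso_def by blast
qed

text \<open>The solution carried by \<alpha>: along the chain of an initial segment the value drops
  from 1 to 0 right after k = \<alpha> j, the one index whose extension is again an initial segment
  of \<alpha>.\<close>

definition on_branch :: "(nat \<Rightarrow> nat) \<Rightarrow> nat \<Rightarrow> bool" where
  "on_branch \<alpha> n \<longleftrightarrow> (\<exists>j. chain n = node \<alpha> j \<and> pos n \<le> \<alpha> j)"

lemma on_branch_xor: "on_branch \<alpha> (left n) \<longleftrightarrow> on_branch \<alpha> n \<noteq> on_branch \<alpha> (right n)"
proof -
  have L: "on_branch \<alpha> (left n) \<longleftrightarrow> (\<exists>j. chain n = node \<alpha> j \<and> pos n = \<alpha> j)"
  proof
    assume "on_branch \<alpha> (left n)"
    then obtain j where "Suc n = node \<alpha> j" by (auto simp: on_branch_def)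
    then obtain i where "n = prod_encode (node \<alpha> i, \<alpha> i)" by (cases j) auto
    then show "\<exists>j. chain n = node \<alpha> j \<and> pos n = \<alpha> j" by auto
  next
    assume "\<exists>j. chain n = node \<alpha> j \<and> pos n = \<alpha> j"
    then obtain j where "chain n = node \<alpha> j" "pos n = \<alpha> j" by blast
    then have "Suc n = node \<alpha> (Suc j)" by (metis node.simps(2) prod_encode_chain_pos)
    then show "on_branch \<alpha> (left n)" by (auto simp: on_branch_def simp del: node.simps intro!: exI[of _ "Suc j"])
  qed
  show ?thesis
  proof (cases "\<exists>j. chain n = node \<alpha> j")
    case True
    then obtain j where "chain n = node \<alpha> j" by blast
    then show ?thesis unfolding L by (auto simp: on_branch_def node_inj)
  qed (unfold L, simp add: on_branch_def)
qed

theorem branch_imp_iso: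
  assumes "\<And>n j. chain n = node \<alpha> j \<Longrightarrow> \<not> N n"
  shows "graph N False \<cong>\<^sub>t\<^sub>o\<^sub>p graph N True"
proof (rule flips_imp_iso)
  show "on_branch \<alpha> 0"
    using chain_prod_encode[of 0 0] pos_prod_encode[of 0 0] by (auto simp: on_branch_def intro!: exI[of _ 0])
  show "on_branch \<alpha> (left n) \<longleftrightarrow> on_branch \<alpha> n \<noteq> on_branch \<alpha> (right n)" for n
    by (rule on_branch_xor)
  show "\<not> on_branch \<alpha> n" if "N n" for n using that assms by (auto simp: on_branch_def)
  show "finite {k. on_branch \<alpha> (prod_encode (m, k))}" for m
  proof (cases "\<exists>j. m = node \<alpha> j")
    case True
    then obtain j where "m = node \<alpha> j" by blast
    then have "{k. on_branch \<alpha> (prod_encode (m, k))} \<subseteq> {..\<alpha> j}" by (auto simp: on_branch_def node_inj)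
    then show ?thesis using finite_subset by blast
  qed (auto simp: on_branch_def)
qed

section \<open>Completeness\<close>

lemma top_graph_iso_imp_equiv: "E \<cong>\<^sub>t\<^sub>o\<^sub>p E' \<Longrightarrow> E \<approx>\<^sub>c\<^sup>i E'"
proof -
  assume "E \<cong>\<^sub>t\<^sub>o\<^sub>p E'"
  then obtain f g where fg: "homeomorphism UNIV UNIV f g" and E: "E' = map_prod f f ` E"
    by (auto simp: top_graph_iso_def)
  then have c: "continuous_on UNIV f" "continuous_on UNIV g" and inv: "\<And>x. g (f x) = x" "\<And>x. f (g x) = x"
    by (auto simp: homeomorphism_def)
  have "inj f" "inj g" using inv by (metis injI)+
  then show "E \<approx>\<^sub>c\<^sup>i E'"
    unfolding inj_cont_hom_equiv_def inj_cont_hom_le_def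
    by (intro conjI exI[of _ f] exI[of _ g]) (auto simp: c E inv)
qed

section \<open>Borel measurability and the reduction\<close>

lemma borel_of_euclidean: "borel_of euclidean = borel"
  by (simp add: borel_of_def borel_def)

lemma measurable_borel_bool:
  assumes "{y \<in> space M. P y} \<in> sets M"
  shows "(P :: 'a \<Rightarrow> bool) \<in> borel_measurable M"
proof (rule borel_measurableI)
  fix S :: "bool set"
  have "{y \<in> space M. \<not> P y} = space M - {y \<in> space M. P y}" by auto
  then have n: "{y \<in> space M. \<not> P y} \<in> sets M" using assms by simp
  have "P -` S \<inter> space M = (if True \<in> S then {y \<in> space M. P y} else {}) \<union>
      (if False \<in> S then {y \<in> space M. \<not> P y} else {})"
    by (rule set_eqI) (case_tac "P x", simp_all)
  then show "P -` S \<inter> space M \<in> sets M" using assms n by simp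
qed

lemma closedin_borel_of: "closedin X S \<Longrightarrow> S \<in> sets (borel_of X)"
proof -
  assume S: "closedin X S"
  have "{U. openin X U} \<subseteq> Pow (topspace X)" by (auto dest: openin_subset)
  then have sp: "space (borel_of X) = topspace X" and st: "sets (borel_of X) = sigma_sets (topspace X) {U. openin X U}"
    by (auto simp: borel_of_def space_measure_of sets_measure_of)
  have "topspace X - S \<in> sets (borel_of X)" using S unfolding st closedin_def by blast
  then have "space (borel_of X) - (topspace X - S) \<in> sets (borel_of X)" by (rule sets.compl_sets)
  moreover have "space (borel_of X) - (topspace X - S) = S" using closedin_subset[OF S] sp by auto
  ultimately show ?thesis by simp
qed

lemma space_borel_of [simp]: "space (borel_of X) = topspace X"
proof -
  have "{U. openin X U} \<subseteq> Pow (topspace X)" by (auto dest: openin_subset)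
  then show ?thesis by (simp add: borel_of_def space_measure_of)
qed

theorem analytic_reduction:
  assumes "analytic_in Y B"
  obtains \<nu> where "\<nu> \<in> borel_of Y \<rightarrow>\<^sub>M borel_of (euclidean :: cantor topology)"
    and "\<And>y. y \<in> B \<Longrightarrow> graph (\<nu> y) False \<cong>\<^sub>t\<^sub>o\<^sub>p graph (\<nu> y) True"
    and "\<And>y. y \<in> topspace Y - B \<Longrightarrow> \<not> graph (\<nu> y) False \<preceq>\<^sub>c\<^sup>i graph (\<nu> y) True"
    and "B \<subseteq> topspace Y"
proof -
  obtain C where C: "\<And>m. closedin Y (C m)" "B = {y \<in> topspace Y. \<exists>\<alpha>. \<forall>j. y \<in> C (node \<alpha> (Suc j))}"
    using analytic_in_normal_form[OF assms] by blast
  \<comment> \<open>Whole chains are forbidden, since \<open>hom_imp_branch\<close> clears only the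
    fibres (s, 0) of a branch while \<open>branch_imp_iso\<close> asks for entire chains. Code 0,
    the empty sequence, is absent from the normal form and stays permitted, as
    \<open>hom_imp_branch\<close> demands.\<close>
  define \<nu> where "\<nu> y n \<longleftrightarrow> chain n \<noteq> 0 \<and> y \<notin> C (chain n)" for y n
  have "(\<lambda>y. \<nu> y n) \<in> borel_measurable (borel_of Y)" for n
  proof (rule measurable_borel_bool)
    have "{y \<in> space (borel_of Y). \<nu> y n} = (if chain n = 0 then {} else space (borel_of Y) - C (chain n))"
      by (auto simp: \<nu>_def)
    also have "\<dots> \<in> sets (borel_of Y)" using sets.compl_sets[OF closedin_borel_of[OF C(1)], of "chain n"] by simp
    finally show "{y \<in> space (borel_of Y). \<nu> y n} \<in> sets (borel_of Y)" .
  qed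
  then have "\<nu> \<in> borel_of Y \<rightarrow>\<^sub>M borel_of (euclidean :: cantor topology)"
    unfolding borel_of_euclidean by (rule measurable_coordinatewise_then_product)
  moreover have "graph (\<nu> y) False \<cong>\<^sub>t\<^sub>o\<^sub>p graph (\<nu> y) True" if "y \<in> B" for y
  proof -
    obtain \<alpha> where \<alpha>: "\<And>j. y \<in> C (node \<alpha> (Suc j))" using \<open>y \<in> B\<close> C(2) by blast
    show ?thesis
    proof (rule branch_imp_iso)
      fix n j assume "chain n = node \<alpha> j"
      then show "\<not> \<nu> y n" using \<alpha> by (cases j) (auto simp: \<nu>_def simp del: node.simps(2))
    qed
  qed
  moreover have "\<not> graph (\<nu> y) False \<preceq>\<^sub>c\<^sup>i graph (\<nu> y) True" if y: "y \<in> topspace Y - B" for y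
  proof
    assume le: "graph (\<nu> y) False \<preceq>\<^sub>c\<^sup>i graph (\<nu> y) True"
    have "\<not> \<nu> y 0" using chain_le[of 0] by (simp add: \<nu>_def)
    with le obtain \<alpha> where "\<And>j. \<not> \<nu> y (prod_encode (node \<alpha> j, 0))"
      using hom_imp_branch[of "\<nu> y"] by blast
    from this[of "Suc j" for j] have "y \<in> C (node \<alpha> (Suc j))" for j by (auto simp: \<nu>_def)
    then show False using y C(2) by blast
  qed
  ultimately show thesis using that C(2) by blast
qed

text \<open>A sandwich: the pair of graphs satisfies the smallest relation in question over B and
  violates the largest one elsewhere, so it decides every A in between.\<close>

lemma complete_analytic_inI:
  assumes S: "C2 \<subseteq> S"
    and A: "analytic_in (prod_topology (subtopology vietoris S) (subtopology vietoris S)) A"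
    and iso: "\<And>E E'. E \<in> C2 \<Longrightarrow> E' \<in> C2 \<Longrightarrow> E \<cong>\<^sub>t\<^sub>o\<^sub>p E' \<Longrightarrow> (E, E') \<in> A"
    and hom: "\<And>E E'. (E, E') \<in> A \<Longrightarrow> E \<preceq>\<^sub>c\<^sup>i E'"
  shows "complete_analytic_in (prod_topology (subtopology vietoris S) (subtopology vietoris S)) A"
    (is "complete_analytic_in ?X A")
  unfolding complete_analytic_in_def
proof (intro conjI A allI impI)
  fix Y :: "nat set topology" and B
  assume "Polish_space Y \<and> analytic_in Y B"
  then obtain \<nu> where \<nu>: "\<nu> \<in> borel_of Y \<rightarrow>\<^sub>M borel_of (euclidean :: cantor topology)"
      "\<And>y. y \<in> B \<Longrightarrow> graph (\<nu> y) False \<cong>\<^sub>t\<^sub>o\<^sub>p graph (\<nu> y) True"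
      "\<And>y. y \<in> topspace Y - B \<Longrightarrow> \<not> graph (\<nu> y) False \<preceq>\<^sub>c\<^sup>i graph (\<nu> y) True" "B \<subseteq> topspace Y"
    using analytic_reduction by metis
  let ?g = "\<lambda>N. (graph N False, graph N True)"
  have "continuous_map euclidean (subtopology vietoris S) (\<lambda>N. graph N r)" for r
    using continuous_map_graph graph_in_C2 S by (auto simp: continuous_map_in_subtopology)
  then have "continuous_map euclidean ?X ?g" by (intro continuous_map_pairedI)
  then have "?g \<circ> \<nu> \<in> borel_of Y \<rightarrow>\<^sub>M borel_of ?X"
    by (intro measurable_comp[OF \<nu>(1)] borel_of_continuous)
  moreover have "(?g \<circ> \<nu>) y \<in> A \<longleftrightarrow> y \<in> B" if "y \<in> topspace Y" for y
  proof (cases "y \<in> B")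
    case True
    then show ?thesis using iso[OF graph_in_C2 graph_in_C2 \<nu>(2)] by simp
  next
    case False
    then have "\<not> graph (\<nu> y) False \<preceq>\<^sub>c\<^sup>i graph (\<nu> y) True" using \<nu>(3) that by blast
    then show ?thesis using False hom[of "graph (\<nu> y) False" "graph (\<nu> y) True"] by auto
  qed
  then have "{y \<in> topspace Y. (?g \<circ> \<nu>) y \<in> A} = B" using \<nu>(4) by blast
  ultimately show "\<exists>g. g \<in> borel_of Y \<rightarrow>\<^sub>M borel_of ?X \<and> {y \<in> topspace Y. g y \<in> A} = B" by blast
qed

lemma complete_analytic_graph_relations:
  assumes S: "S = colorable_graphs k" "C2 \<subseteq> S"
  shows "complete_analytic_in (prod_topology (subtopology vietoris S) (subtopology vietoris S))
      {(E, E'). E \<in> S \<and> E' \<in> S \<and> E \<cong>\<^sub>t\<^sub>o\<^sub>p E'}"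
    and "complete_analytic_in (prod_topology (subtopology vietoris S) (subtopology vietoris S))
      {(E, E'). E \<in> S \<and> E' \<in> S \<and> E \<approx>\<^sub>c\<^sup>i E'}"
proof -
  have nc: "S \<subseteq> nonempty_compacts" and P: "Polish (subtopology vietoris S)"
    using Polish_colorable_graphs unfolding S(1) by (auto simp: colorable_graphs_def)
  have le: "E \<preceq>\<^sub>c\<^sup>i E'" if "E \<cong>\<^sub>t\<^sub>o\<^sub>p E'" for E E' :: "(cantor \<times> cantor) set"
    using top_graph_iso_imp_equiv[OF that] by (simp add: inj_cont_hom_equiv_def)
  show "complete_analytic_in (prod_topology (subtopology vietoris S) (subtopology vietoris S))
      {(E, E'). E \<in> S \<and> E' \<in> S \<and> E \<cong>\<^sub>t\<^sub>o\<^sub>p E'}"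
    using S(2) le by (intro complete_analytic_inI analytic_top_graph_iso[OF nc P]) auto
  show "complete_analytic_in (prod_topology (subtopology vietoris S) (subtopology vietoris S))
      {(E, E'). E \<in> S \<and> E' \<in> S \<and> E \<approx>\<^sub>c\<^sup>i E'}"
    using S(2) top_graph_iso_imp_equiv
    by (intro complete_analytic_inI analytic_inj_cont_hom_equiv[OF nc P]) (auto simp: inj_cont_hom_equiv_def)
qed

theorem theorem1p4:
  shows "complete_analytic_in (prod_topology C2_space C2_space)
           {(E, E'). E \<in> C2 \<and> E' \<in> C2 \<and> E \<cong>\<^sub>t\<^sub>o\<^sub>p E'}
    \<and> complete_analytic_in (prod_topology C2_space C2_space)
           {(E, E'). E \<in> C2 \<and> E' \<in> C2 \<and> E \<approx>\<^sub>c\<^sup>i E'}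
    \<and> complete_analytic_in (prod_topology C23_space C23_space)
           {(E, E'). E \<in> C23 \<and> E' \<in> C23 \<and> E \<cong>\<^sub>t\<^sub>o\<^sub>p E'}
    \<and> complete_analytic_in (prod_topology C23_space C23_space)
           {(E, E'). E \<in> C23 \<and> E' \<in> C23 \<and> E \<approx>\<^sub>c\<^sup>i E'}"
proof -
  have "C2 \<subseteq> C23" by (auto simp: C2_def)
  then show ?thesis
    unfolding C2_space_def C23_space_def
    by (intro conjI complete_analytic_graph_relations[OF C2_eq] complete_analytic_graph_relations[OF C23_eq]) auto
qed

end
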